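(* Let $N, m, K$ be positive integers, let $f \subseteq \{0,1\}^N \times [K]$ be a relation such that for every $z \in \{0,1\}^N$ there is $a \in [K]$ with $(z,a) \in f$, and let $g : \{0,1\}^m \to \{0,1\}$ be a Boolean function. Then $$\mathrm{ADV}_{rel}^{\pm}(f \circ g^N) = \mathrm{ADV}_{rel}^{\pm}(f)\, \mathrm{ADV}^{\pm}(g).$$
   Context: $[K] = \{1,\dots,K\}$. The composition of a relation $f \subseteq \{0,1\}^N \times [K]$ with $g:\{0,1\}^m\to\{0,1\}$ is the relation $f\circ g^N \subseteq \{0,1\}^{Nm} \times [K]$ where, for $x = (x_1,\dots,x_N)$ with each $x_i \in \{0,1\}^m$, $(x,a) \in f \circ g^N$ iff $((g(x_1),\dots,g(x_N)),a) \in f$. Functional adversary bound: for $g:\{0,1\}^n\to\{0,1\}$, $\mathrm{ADV}^{\pm}(g)$ is the maximum of the spectral norm $\|\Gamma\|$ over real symmetric $2^n\times 2^n$ matrices $\Gamma$ (rows and columns indexed by $\{0,1\}^n$) such that $\Gamma(x,y)=0$ whenever $g(x)=g(y)$, and $\|\Gamma\circ D_i\|\le 1$ for all $i\in[n]$. Here $\circ$ between matrices is the entrywise (Hadamard) product and $D_i$ is the $0/1$ matrix with $D_i(x,y)=1$ iff $x_i\ne y_i$. Relational adversary bound: for a relation $f\subseteq\{0,1\}^n\times[K]$ (where every $x$ has some $a$ with $(x,a)\in f$), $\mathrm{ADV}_{rel}^{\pm}(f)$ is the minimum of $$\max\Big\{\max_{x}\sum_{i\in[n]}\|u_{x,i}\|^2,\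 \max_{x}\sum_{i\in[n]}\|v_{x,i}\|^2\Big\}$$ over families of real vectors $u_{x,i}, v_{x,i}, \sigma_{x,a}$ of arbitrary finite dimension ($x\in\{0,1\}^n$, $i\in[n]$, $a\in[K]$; dimensions such that the inner products below make sense) satisfying $$\sum_{i: x_i\ne y_i}\langle u_{x,i},v_{y,i}\rangle = 1-\sum_{a\in[K]}\langle\sigma_{x,a},\sigma_{y,a}\rangle\quad\text{for all }x,y\in\{0,1\}^n,$$ and $\sigma_{x,a}=0$ whenever $(x,a)\notin f$. *)

theory Defs
  imports "HOL-Analysis.Analysis"
begin

text \<open>
  Throughout, \<open>{0,1}\<^sup>n\<close> is the type \<open>bool ^ 'n\<close> with \<open>n = CARD('n)\<close>, and \<open>[K]\<close> is a finite type
  \<open>'k\<close> with \<open>K = CARD('k)\<close>. Types are non-empty, so these cardinalities are exactly the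
  positive integers.
\<close>

text \<open>
  Strings of length \<open>N * m\<close> are indexed by pairs: \<open>x $ (i, j)\<close> is the \<open>j\<close>-th bit of the \<open>i\<close>-th
  block of \<open>x\<close>.
\<close>

definition block :: "bool ^ ('n::finite \<times> 'm::finite) \<Rightarrow> 'n \<Rightarrow> bool ^ 'm" where
  "block x i = (\<chi> j. x $ (i, j))"

definition rel_compose ::
  "((bool ^ 'n::finite) \<times> 'k) set \<Rightarrow> (bool ^ 'm::finite \<Rightarrow> bool) \<Rightarrow>
   ((bool ^ ('n \<times> 'm)) \<times> 'k) set" where
  "rel_compose f g = {(x, a). ((\<chi> i. g (block x i)), a) \<in> f}"

definition hadamard :: "real ^ 'b::finite ^ 'a::finite \<Rightarrow> real ^ 'b ^ 'a \<Rightarrow> real ^ 'b ^ 'a" where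
  "hadamard A B = (\<chi> x y. A $ x $ y * B $ x $ y)"

definition diff_matrix :: "'n::finite \<Rightarrow> real ^ (bool ^ 'n) ^ (bool ^ 'n)" where
  "diff_matrix i = (\<chi> x y. if x $ i \<noteq> y $ i then 1 else 0)"

definition spectral_norm :: "real ^ 'b::finite ^ 'a::finite \<Rightarrow> real" where
  "spectral_norm A = onorm (\<lambda>v. A *v v)"

definition adversary_matrix ::
  "(bool ^ 'n::finite \<Rightarrow> bool) \<Rightarrow> real ^ (bool ^ 'n) ^ (bool ^ 'n) \<Rightarrow> bool" where
  "adversary_matrix g \<Gamma> \<longleftrightarrow>
     transpose \<Gamma> = \<Gamma> \<and>
     (\<forall>x y. g x = g y \<longrightarrow> \<Gamma> $ x $ y = 0) \<and>
     (\<forall>i. spectral_norm (hadamard \<Gamma> (diff_matrix i)) \<le> 1)"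

text \<open>
  The supremum is a maximum: the zero matrix is feasible, the constraints are closed, and they
  bound every entry of \<open>\<Gamma>\<close> by 1 in absolute value.
\<close>

definition ADV :: "(bool ^ 'n::finite \<Rightarrow> bool) \<Rightarrow> real" where
  "ADV g = Sup {spectral_norm \<Gamma> | \<Gamma>. adversary_matrix g \<Gamma>}"

text \<open>
  The dimension of the vectors is existentially quantified inside the relational bound, so a vector
  in \<open>\<real>\<^sup>d\<close> is a function on \<open>nat\<close> of which only the values at arguments below \<open>d\<close> matter.
\<close>

definition dot :: "nat \<Rightarrow> (nat \<Rightarrow> real) \<Rightarrow> (nat \<Rightarrow> real) \<Rightarrow> real" where
  "dot d u v = (\<Sum>k<d. u k * v k)"

text \<open>
  All \<open>u x i\<close> and \<open>v x i\<close> live in \<open>\<real>\<^sup>d\<close> and all \<open>\<sigma> x a\<close> in \<open>\<real>\<^sup>e\<close>. Dimensions varying with the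
  indices give nothing more, since vectors can be padded with zeros.
\<close>

definition rel_feasible ::
  "((bool ^ 'n::finite) \<times> 'k::finite) set \<Rightarrow> nat \<Rightarrow> nat \<Rightarrow>
   (bool ^ 'n \<Rightarrow> 'n \<Rightarrow> nat \<Rightarrow> real) \<Rightarrow> (bool ^ 'n \<Rightarrow> 'n \<Rightarrow> nat \<Rightarrow> real) \<Rightarrow>
   (bool ^ 'n \<Rightarrow> 'k \<Rightarrow> nat \<Rightarrow> real) \<Rightarrow> bool" where
  "rel_feasible f d e u v \<sigma> \<longleftrightarrow>
     (\<forall>x y. (\<Sum>i\<in>{i. x $ i \<noteq> y $ i}. dot d (u x i) (v y i)) =
            1 - (\<Sum>a\<in>UNIV. dot e (\<sigma> x a) (\<sigma> y a))) \<and>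
     (\<forall>x a. (x, a) \<notin> f \<longrightarrow> (\<forall>k<e. \<sigma> x a k = 0))"

definition rel_cost ::
  "nat \<Rightarrow> (bool ^ 'n::finite \<Rightarrow> 'n \<Rightarrow> nat \<Rightarrow> real) \<Rightarrow> (bool ^ 'n \<Rightarrow> 'n \<Rightarrow> nat \<Rightarrow> real) \<Rightarrow> real" where
  "rel_cost d u v =
     max (MAX x. \<Sum>i\<in>UNIV. dot d (u x i) (u x i))
         (MAX x. \<Sum>i\<in>UNIV. dot d (v x i) (v x i))"

text \<open>
  For a total relation the infimum is a minimum: feasible families exist, and as everything depends
  only on inner products, the dimensions may be bounded by the number of vectors, which gives
  compactness.
\<close>

definition ADV_rel :: "((bool ^ 'n::finite) \<times> 'k::finite) set \<Rightarrow> real" where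
  "ADV_rel f = Inf {rel_cost d u v | d e u v \<sigma>. rel_feasible f d e u v \<sigma>}"

end

theory Submission
  imports Defs
begin

text \<open>
  Upper bound. Separating a cone from a point gives the dual of \<open>ADV g\<close>: for \<open>W > ADV g\<close> there are
  positive semidefinite \<open>X\<^sub>j\<close> with \<open>\<Sum>\<^bsub>j: x\<^sub>j \<noteq> y\<^sub>j\<^esub> X\<^sub>j(x, y) = 1\<close> whenever \<open>g x \<noteq> g y\<close>, and
  \<open>\<Sum>\<^sub>j X\<^sub>j(x, x) \<le> W\<close>. Tensoring their Gram vectors with a feasible family for \<open>f\<close> yields one for \<open>f \<circ> g\<^sup>N\<close>
  whose cost is at most \<open>W\<close> times larger. Working with every \<open>W > ADV g\<close> avoids any closedness argument.

  Lower bound. Let \<open>\<Gamma>\<close> be an adversary matrix of norm \<open>\<mu>\<close>, attained at unit vectors on \<open>g\<^sup>-\<^sup>1(0)\<close> and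
  \<open>g\<^sup>-\<^sup>1(1)\<close> with entries \<open>\<delta>\<close>. The matrix \<open>A = I + \<Gamma>/\<mu>\<close> is positive semidefinite, hence so are its tensor
  power and the kernel \<open>\<Psi>(x, y) = \<Prod>\<^sub>l \<delta>(x\<^sub>l) \<delta>(y\<^sub>l) A(x\<^sub>l, y\<^sub>l)\<close>, whose sum over the \<open>x\<close> above \<open>z\<close> and the
  \<open>y\<close> above \<open>z'\<close> is 1. Averaging the constraints of a feasible family for \<open>f \<circ> g\<^sup>N\<close> against \<open>\<Psi>\<close> gives the
  constraints for \<open>f\<close>. On the left-hand side, the \<open>l\<close>-th factor of \<open>\<Psi>\<close> for the queried block becomes
  \<open>(\<Gamma> \<circ> D\<^sub>j)/\<mu>\<close>; realising \<open>\<Gamma> \<circ> D\<^sub>j\<close> by Gram vectors of \<open>I + \<Gamma> \<circ> D\<^sub>j\<close>, which are orthonormal on each of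
  \<open>g\<^sup>-\<^sup>1(0)\<close> and \<open>g\<^sup>-\<^sup>1(1)\<close>, divides the cost by \<open>\<mu>\<close>.
\<close>

subsection \<open>Gram representations and the relational bound\<close>

text \<open>Induction on \<open>S\<close> by Cholesky elimination. The vectors are indexed by
  \<open>S\<close> itself, so their dimension is the size of the matrix. They supply the tensor
  factors in both bounds.\<close>

lemma psd_gram:
  fixes A :: "'a \<Rightarrow> 'a \<Rightarrow> real"
  assumes "finite S"
    and "\<And>a b. a \<in> S \<Longrightarrow> b \<in> S \<Longrightarrow> A a b = A b a"
    and "\<And>c. 0 \<le> (\<Sum>a\<in>S. \<Sum>b\<in>S. c a * c b * A a b)"
  shows "\<exists>r. \<forall>a\<in>S. \<forall>b\<in>S. A a b = (\<Sum>s\<in>S. r a s * r b s)"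
  using assms
proof (induction S arbitrary: A rule: finite_induct)
  case empty
  then show ?case by simp
next
  case (insert t S)
  have expand: "(\<Sum>a\<in>insert t S. \<Sum>b\<in>insert t S. c a * c b * A a b) =
      (c t)\<^sup>2 * A t t + 2 * c t * (\<Sum>b\<in>S. c b * A t b) + (\<Sum>a\<in>S. \<Sum>b\<in>S. c a * c b * A a b)" for c
  proof -
    have "(\<Sum>a\<in>S. c a * c t * A a t) = (\<Sum>b\<in>S. c t * c b * A t b)"
      using insert.prems(1) by (intro sum.cong) auto
    then show ?thesis
      using insert.hyps
      by (simp add: sum.distrib sum_distrib_left power2_eq_square algebra_simps)
  qed
  have tt: "0 \<le> A t t"
    using insert.prems(2)[of "\<lambda>a. if a = t then 1 else 0"] insert.hyps
    unfolding expand by (simp add: sum.neutral if_distrib[of "\<lambda>x. x * _"] cong: if_cong)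
  have zero: "A t b = 0" if b: "b \<in> S" and 0: "A t t = 0" for b
  proof (rule ccontr)
    assume nz: "A t b \<noteq> 0"
    \<comment> \<open>With \<open>A t t = 0\<close>, the form with value \<open>s\<close> at
      \<open>t\<close> and 1 at \<open>b\<close> is \<open>2 * s * A t b + A b b\<close>, linear in
      \<open>s\<close>; this choice makes it -1.\<close>
    define s where "s = - (A b b + 1) / (2 * A t b)"
    define c where "c = (\<lambda>a. if a = t then s else if a = b then 1 else 0)"
    have "t \<noteq> b" using b insert.hyps by auto
    then have ct: "c t = s" and cS: "\<And>a. a \<in> S \<Longrightarrow> c a = (if a = b then 1 else 0)"
      using insert.hyps by (auto simp: c_def)
    have "(\<Sum>a\<in>S. c a * A t a) = (\<Sum>a\<in>S. if a = b then A t a else 0)"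
      by (intro sum.cong) (auto simp: cS)
    then have 1: "(\<Sum>a\<in>S. c a * A t a) = A t b"
      using b insert.hyps by simp
    have "(\<Sum>a\<in>S. \<Sum>a'\<in>S. c a * c a' * A a a') = (\<Sum>a\<in>S. \<Sum>a'\<in>S. if a' = b then (if a = b then A a a' else 0) else 0)"
      by (intro sum.cong) (auto simp: cS)
    then have 2: "(\<Sum>a\<in>S. \<Sum>a'\<in>S. c a * c a' * A a a') = A b b"
      using b insert.hyps by simp
    have "0 \<le> 2 * s * A t b + A b b"
      using insert.prems(2)[of c] unfolding expand 1 2 ct 0 by simp
    then show False using nz by (simp add: s_def field_simps)
  qed
  \<comment> \<open>Schur complement (Cholesky step). If \<open>A t t = 0\<close>, row \<open>t\<close> vanishes, so division by zero gives the right value.\<close>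
  define A' where "A' = (\<lambda>a b. A a b - A a t * A t b / A t t)"
  have psd': "0 \<le> (\<Sum>a\<in>S. \<Sum>b\<in>S. c a * c b * A' a b)" for c
  proof -
    define q where "q = (\<Sum>b\<in>S. c b * A t b)"
    \<comment> \<open>The value at \<open>t\<close> minimises the form for given values on
      \<open>S\<close>, and the minimum is the form of \<open>A'\<close>.\<close>
    define c' where "c' = c(t := - q / A t t)"
    have cS: "\<And>a. a \<in> S \<Longrightarrow> c' a = c a" and ct: "c' t = - q / A t t"
      using insert.hyps by (auto simp: c'_def)
    have "(\<Sum>a\<in>S. \<Sum>b\<in>S. c a * c b * A' a b) =
        (\<Sum>a\<in>S. \<Sum>b\<in>S. c a * c b * A a b) - (\<Sum>a\<in>S. \<Sum>b\<in>S. (c a * A t a) * (c b * A t b)) / A t t"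
      unfolding sum_divide_distrib sum_subtractf[symmetric]
      using insert.prems(1) by (intro sum.cong) (auto simp: A'_def algebra_simps)
    also have "(\<Sum>a\<in>S. \<Sum>b\<in>S. (c a * A t a) * (c b * A t b)) = q * q"
      unfolding q_def by (rule sum_product[symmetric])
    also have "(\<Sum>a\<in>S. \<Sum>b\<in>S. c a * c b * A a b) - q * q / A t t =
       (\<Sum>a\<in>insert t S. \<Sum>b\<in>insert t S. c' a * c' b * A a b)"
      unfolding expand ct
      by (cases "A t t = 0") (simp_all add: cS q_def[symmetric] power2_eq_square field_simps)
    finally show ?thesis using insert.prems(2)[of c'] by simp
  qed
  have "\<exists>r. \<forall>a\<in>S. \<forall>b\<in>S. A' a b = (\<Sum>s\<in>S. r a s * r b s)"
    using insert.prems(1) by (intro insert.IH psd') (simp add: A'_def mult.commute)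
  then obtain r where r: "\<And>a b. a \<in> S \<Longrightarrow> b \<in> S \<Longrightarrow> A' a b = (\<Sum>s\<in>S. r a s * r b s)"
    by blast
  \<comment> \<open>Coordinate \<open>t\<close> carries the rank-one part subtracted in
    \<open>A'\<close>; the vector of \<open>t\<close> lies along it alone, and the other coordinates
    come from the induction hypothesis.\<close>
  define r' where "r' = (\<lambda>a s. if s = t then A a t / sqrt (A t t) else if a = t then 0 else r a s)"
  have *: "(\<Sum>s\<in>insert t S. r' a s * r' b s) = A a t * A b t / A t t +
      (if a = t \<or> b = t then 0 else \<Sum>s\<in>S. r a s * r b s)" for a b
  proof -
    have "(\<Sum>s\<in>S. r' a s * r' b s) = (\<Sum>s\<in>S. if a = t \<or> b = t then 0 else r a s * r b s)"
      using insert.hyps by (intro sum.cong) (auto simp: r'_def)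
    moreover have "r' a t * r' b t = A a t * A b t / A t t"
      using tt by (simp add: r'_def)
    ultimately show ?thesis using insert.hyps by simp
  qed
  have "A a b = (\<Sum>s\<in>insert t S. r' a s * r' b s)" if ab: "a \<in> insert t S" "b \<in> insert t S" for a b
  proof (cases "a = t \<or> b = t")
    case True
    have "A b t = A t b" "A a t = A t a" "A a b = A b a"
      using ab insert.prems(1) by auto
    then show ?thesis
      using True ab zero[of a] zero[of b] unfolding * by (cases "A t t = 0") auto
  next
    case False
    then have "a \<in> S" "b \<in> S" using ab by auto
    then show ?thesis
      using False insert.prems(1)[of b t] unfolding * r[symmetric, OF \<open>a \<in> S\<close> \<open>b \<in> S\<close>] by (simp add: A'_def)
  qed
  then show ?case by blast
qed

lemma rel_cost_nonneg: "0 \<le> rel_cost d u v"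
proof -
  have "0 \<le> (\<Sum>i\<in>UNIV. dot d (u undefined i) (u undefined i))"
    by (auto simp: dot_def intro!: sum_nonneg)
  also have "\<dots> \<le> (MAX x. \<Sum>i\<in>UNIV. dot d (u x i) (u x i))"
    by (rule Max_ge) auto
  finally show ?thesis by (simp add: rel_cost_def)
qed

lemma rel_cost_le_iff:
  "rel_cost d u v \<le> W \<longleftrightarrow>
    (\<forall>x. (\<Sum>i\<in>UNIV. dot d (u x i) (u x i)) \<le> W) \<and> (\<forall>x. (\<Sum>i\<in>UNIV. dot d (v x i) (v x i)) \<le> W)"
  unfolding rel_cost_def by (simp add: Max_le_iff)

lemma ADV_rel_le_cost: "rel_feasible f d e u v \<sigma> \<Longrightarrow> ADV_rel f \<le> rel_cost d u v"
  unfolding ADV_rel_def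
  by (intro cInf_lower bdd_belowI[of _ 0]) (use rel_cost_nonneg in blast)+

text \<open>The constructions below index coordinates by tuples, while feasibility asks for vectors
  indexed by naturals; enumerating \<open>I\<close> and \<open>J\<close> bridges the two.\<close>

lemma rel_feasible_of_indexed:
  fixes f :: "((bool ^ 'n::finite) \<times> 'k::finite) set"
    and u v :: "bool ^ 'n \<Rightarrow> 'n \<Rightarrow> 'b \<Rightarrow> real" and \<sigma> :: "bool ^ 'n \<Rightarrow> 'k \<Rightarrow> 'c \<Rightarrow> real"
  assumes fin: "finite I" "finite J"
    and eq: "\<And>x y. (\<Sum>i\<in>{i. x $ i \<noteq> y $ i}. \<Sum>k\<in>I. u x i k * v y i k) =
        1 - (\<Sum>a\<in>UNIV. \<Sum>k\<in>J. \<sigma> x a k * \<sigma> y a k)"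
    and zero: "\<And>x a k. (x, a) \<notin> f \<Longrightarrow> \<sigma> x a k = 0"
    and u: "\<And>x. (\<Sum>i\<in>UNIV. \<Sum>k\<in>I. (u x i k)\<^sup>2) \<le> W"
    and v: "\<And>x. (\<Sum>i\<in>UNIV. \<Sum>k\<in>I. (v x i k)\<^sup>2) \<le> W"
  shows "\<exists>d e u v \<sigma>. rel_feasible f d e u v \<sigma> \<and> rel_cost d u v \<le> W"
proof -
  obtain h where h: "bij_betw h {..<card I} I"
    using ex_bij_betw_nat_finite[OF fin(1)] by (auto simp: atLeast0LessThan)
  obtain h' where h': "bij_betw h' {..<card J} J"
    using ex_bij_betw_nat_finite[OF fin(2)] by (auto simp: atLeast0LessThan)
  define u' where "u' = (\<lambda>x i k. u x i (h k))"
  define v' where "v' = (\<lambda>x i k. v x i (h k))"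
  define \<sigma>' where "\<sigma>' = (\<lambda>x a k. \<sigma> x a (h' k))"
  have uv: "dot (card I) (u' x i) (v' y i) = (\<Sum>k\<in>I. u x i k * v y i k)"
    and uu: "dot (card I) (u' x i) (u' x i) = (\<Sum>k\<in>I. (u x i k)\<^sup>2)"
    and vv: "dot (card I) (v' x i) (v' x i) = (\<Sum>k\<in>I. (v x i k)\<^sup>2)" for x y i
    using sum.reindex_bij_betw[OF h, of "\<lambda>k. u x i k * v y i k"]
      sum.reindex_bij_betw[OF h, of "\<lambda>k. (u x i k)\<^sup>2"] sum.reindex_bij_betw[OF h, of "\<lambda>k. (v x i k)\<^sup>2"]
    by (simp_all add: dot_def u'_def v'_def power2_eq_square)
  have ss: "dot (card J) (\<sigma>' x a) (\<sigma>' y a) = (\<Sum>k\<in>J. \<sigma> x a k * \<sigma> y a k)" for x y a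
    using sum.reindex_bij_betw[OF h', of "\<lambda>k. \<sigma> x a k * \<sigma> y a k"]
    by (simp add: dot_def \<sigma>'_def)
  have "rel_feasible f (card I) (card J) u' v' \<sigma>'"
    unfolding rel_feasible_def uv ss using eq zero by (auto simp: \<sigma>'_def)
  moreover have "rel_cost (card I) u' v' \<le> W"
    unfolding rel_cost_le_iff uu vv using u v by simp
  ultimately show ?thesis by blast
qed

text \<open>Makes the infimum range over a nonempty set. \<open>\<sigma>\<close> puts the basis
  vector of \<open>x\<close> at one valid answer, so its Gram sum is 1 if \<open>x = y\<close> and 0
  otherwise; each position where \<open>x\<close> and \<open>y\<close> differ contributes the
  reciprocal of their Hamming distance.\<close>

lemma rel_feasible_exists:
  fixes f :: "((bool ^ 'n::finite) \<times> 'k::finite) set"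
  assumes "\<forall>z. \<exists>a. (z, a) \<in> f"
  shows "\<exists>d e u v \<sigma>. rel_feasible f d e u v \<sigma>"
proof -
  obtain h where h: "\<And>z. (z, h z) \<in> f" using assms by metis
  define u :: "bool ^ 'n \<Rightarrow> 'n \<Rightarrow> bool ^ 'n \<Rightarrow> real"
    where "u = (\<lambda>x i w. if w = x then 1 else 0)"
  define v :: "bool ^ 'n \<Rightarrow> 'n \<Rightarrow> bool ^ 'n \<Rightarrow> real"
    where "v = (\<lambda>y i w. 1 / real (card {i. w $ i \<noteq> y $ i}))"
  define \<sigma> :: "bool ^ 'n \<Rightarrow> 'k \<Rightarrow> bool ^ 'n \<Rightarrow> real"
    where "\<sigma> = (\<lambda>x a w. if a = h x \<and> w = x then 1 else 0)"
  define W where "W = max (MAX x. \<Sum>i\<in>UNIV. \<Sum>k\<in>UNIV. (u x i k)\<^sup>2) (MAX x. \<Sum>i\<in>UNIV. \<Sum>k\<in>UNIV. (v x i k)\<^sup>2)"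
  have "\<exists>d e u v \<sigma>. rel_feasible f d e u v \<sigma> \<and> rel_cost d u v \<le> W"
  proof (rule rel_feasible_of_indexed[where I = UNIV and J = UNIV and u = u and v = v and \<sigma> = \<sigma>])
    fix x y :: "bool ^ 'n"
    have 1: "(\<Sum>a\<in>UNIV. \<Sum>k\<in>UNIV. \<sigma> x a k * \<sigma> y a k) = (if x = y then 1 else 0)"
    proof -
      have "\<sigma> x a k * \<sigma> y a k = (if k = x then (if a = h x then (if x = y then 1 else 0) else 0) else 0)" for a k
        by (auto simp: \<sigma>_def)
      then show ?thesis by simp
    qed
    have "(\<Sum>i\<in>{i. x $ i \<noteq> y $ i}. \<Sum>k\<in>UNIV. u x i k * v y i k) =
       (\<Sum>i\<in>{i. x $ i \<noteq> y $ i}. 1 / real (card {i. x $ i \<noteq> y $ i}))"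
    proof (intro sum.cong refl)
      fix i
      have "u x i k * v y i k = (if k = x then v y i k else 0)" for k
        by (simp add: u_def)
      then show "(\<Sum>k\<in>UNIV. u x i k * v y i k) = 1 / real (card {i. x $ i \<noteq> y $ i})"
        by (simp add: v_def)
    qed
    also have "\<dots> = (if x = y then 0 else 1)"
      by (auto simp: vec_eq_iff card_eq_0_iff)
    finally show "(\<Sum>i\<in>{i. x $ i \<noteq> y $ i}. \<Sum>k\<in>UNIV. u x i k * v y i k) =
        1 - (\<Sum>a\<in>UNIV. \<Sum>k\<in>UNIV. \<sigma> x a k * \<sigma> y a k)"
      using 1 by simp
  qed (auto simp: \<sigma>_def W_def h le_max_iff_disj intro!: Max_ge disjI1 disjI2)
  then show ?thesis by blast
qed

subsection \<open>Spectral norms\<close>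

lemma spectral_norm_nonneg: "0 \<le> spectral_norm A"
  unfolding spectral_norm_def by (rule onorm_pos_le[OF matrix_vector_mul_bounded_linear])

lemma norm_le_spectral_norm: "norm (A *v v) \<le> spectral_norm A * norm v"
  unfolding spectral_norm_def by (rule onorm[OF matrix_vector_mul_bounded_linear])

lemma inner_matrix_vector:
  fixes A :: "real ^ 'b::finite ^ 'a::finite"
  shows "v \<bullet> (A *v w) = (\<Sum>x\<in>UNIV. \<Sum>y\<in>UNIV. v $ x * w $ y * A $ x $ y)"
  by (simp add: inner_vec_def matrix_vector_mult_def sum_distrib_left mult_ac)

text \<open>The mean of squares, unlike the product of norms, is additive over orthogonal
  components, which is needed when vectors are split by the value of \<open>g\<close>. For the
  converse, rescaling \<open>A *v w\<close> to the length of \<open>w\<close> makes the mean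
  inequality tight.\<close>

lemma spectral_norm_le_iff:
  fixes A :: "real ^ 'b::finite ^ 'a::finite"
  shows "spectral_norm A \<le> \<mu> \<longleftrightarrow> (\<forall>v w. v \<bullet> (A *v w) \<le> \<mu> * ((norm v)\<^sup>2 + (norm w)\<^sup>2) / 2)"
proof (intro iffI allI)
  fix v w assume \<mu>: "spectral_norm A \<le> \<mu>"
  have "v \<bullet> (A *v w) \<le> norm v * norm (A *v w)"
    by (rule norm_cauchy_schwarz)
  also have "\<dots> \<le> norm v * (\<mu> * norm w)"
    by (intro mult_left_mono order_trans[OF norm_le_spectral_norm] mult_right_mono \<mu>) auto
  also have "\<dots> = \<mu> * (norm v * norm w)"
    by simp
  also have "\<dots> \<le> \<mu> * (((norm v)\<^sup>2 + (norm w)\<^sup>2) / 2)"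
    using sum_squares_bound[of "norm v" "norm w"] spectral_norm_nonneg[of A] \<mu>
    by (intro mult_left_mono) (auto simp: mult.assoc)
  finally show "v \<bullet> (A *v w) \<le> \<mu> * ((norm v)\<^sup>2 + (norm w)\<^sup>2) / 2" by simp
next
  assume *: "\<forall>v w. v \<bullet> (A *v w) \<le> \<mu> * ((norm v)\<^sup>2 + (norm w)\<^sup>2) / 2"
  show "spectral_norm A \<le> \<mu>"
    unfolding spectral_norm_def
  proof (rule onorm_le)
    fix w
    show "norm (A *v w) \<le> \<mu> * norm w"
    proof (cases "w = 0 \<or> A *v w = 0")
      case True
      have "0 \<le> \<mu> * (norm w)\<^sup>2"
        using *[rule_format, of 0 w] by simp
      then show ?thesis using True by (auto simp: zero_le_mult_iff)
    next
      case False
      define t where "t = norm w / norm (A *v w)"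
      have "t * (norm (A *v w))\<^sup>2 \<le> \<mu> * ((t * norm (A *v w))\<^sup>2 + (norm w)\<^sup>2) / 2"
        using *[rule_format, of "t *\<^sub>R (A *v w)" w]
        by (simp add: power2_norm_eq_inner power_mult_distrib)
      moreover have "t * norm (A *v w) = norm w"
        using False by (simp add: t_def)
      ultimately have "norm w * norm (A *v w) \<le> norm w * (\<mu> * norm w)"
        by (simp add: power2_eq_square mult_ac) (metis mult.assoc mult.commute)
      then show ?thesis using False by simp
    qed
  qed
qed

text \<open>No eigenvalue of \<open>\<Gamma>\<close> is below \<open>- \<mu>\<close>, so the
  identity plus \<open>\<Gamma> / \<mu>\<close> is positive semidefinite. Where
  \<open>\<Gamma>\<close> vanishes, the resulting vectors are orthonormal.\<close>

lemma gram_identity_plus: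
  fixes \<Gamma> :: "real ^ 'a::finite ^ 'a"
  assumes "transpose \<Gamma> = \<Gamma>" "spectral_norm \<Gamma> \<le> \<mu>" "0 < \<mu>"
  shows "\<exists>r :: 'a \<Rightarrow> 'a \<Rightarrow> real. \<forall>a b. (\<Sum>s\<in>UNIV. r a s * r b s) = (if a = b then 1 else 0) + \<Gamma> $ a $ b / \<mu>"
proof -
  have "\<exists>r :: 'a \<Rightarrow> 'a \<Rightarrow> real. \<forall>a\<in>UNIV. \<forall>b\<in>UNIV. (if a = b then 1 else 0) + \<Gamma> $ a $ b / \<mu> = (\<Sum>s\<in>UNIV. r a s * r b s)"
  proof (rule psd_gram[where A = "\<lambda>a b. (if a = b then 1 else 0) + \<Gamma> $ a $ b / \<mu>"])
    fix c :: "'a \<Rightarrow> real"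
    define v where "v = vec_lambda c"
    have "- (v \<bullet> (\<Gamma> *v v)) \<le> \<mu> * (norm v)\<^sup>2"
      using assms(2)[unfolded spectral_norm_le_iff, rule_format, of "- v" v] by simp
    then have "0 \<le> (norm v)\<^sup>2 + (v \<bullet> (\<Gamma> *v v)) / \<mu>"
      using assms(3) by (simp add: field_simps)
    also have "(norm v)\<^sup>2 = (\<Sum>a\<in>UNIV. \<Sum>b\<in>UNIV. c a * c b * (if a = b then 1 else 0))"
    proof -
      have "c a * c b * (if a = b then 1 else 0) = (if b = a then c a * c a else 0)" for a b
        by simp
      then show ?thesis
        by (simp add: power2_norm_eq_inner inner_vec_def v_def)
    qed
    also have "\<dots> + (v \<bullet> (\<Gamma> *v v)) / \<mu> =
        (\<Sum>a\<in>UNIV. \<Sum>b\<in>UNIV. c a * c b * ((if a = b then 1 else 0) + \<Gamma> $ a $ b / \<mu>))"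
      by (simp only: inner_matrix_vector v_def vec_lambda_beta sum_divide_distrib
          sum.distrib[symmetric] distrib_left times_divide_eq_right)
    finally show "0 \<le> \<dots>" .
  next
    fix a b :: 'a
    show "(if a = b then 1 else 0) + \<Gamma> $ a $ b / \<mu> = (if b = a then 1 else 0) + \<Gamma> $ b $ a / \<mu>"
      using arg_cong[OF assms(1), of "\<lambda>M. M $ a $ b"] by (auto simp: transpose_def)
  qed simp
  then show ?thesis by (metis UNIV_I)
qed

text \<open>\<open>\<Gamma>\<close> is block off-diagonal for the level sets of \<open>g\<close>, so
  its norm is the top singular value of one block. Compactness gives unit vectors \<open>p\<close>
  and \<open>q\<close> on the two sides attaining it, and \<open>\<delta>\<close> glues them
  together.\<close>

lemma adversary_extremal_weight:
  fixes \<Gamma> :: "real ^ 'a::finite ^ 'a" and g :: "'a \<Rightarrow> bool"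
  assumes sym: "transpose \<Gamma> = \<Gamma>" and supp: "\<And>x y. g x = g y \<Longrightarrow> \<Gamma> $ x $ y = 0"
    and pos: "0 < spectral_norm \<Gamma>"
  shows "\<exists>(\<delta> :: 'a \<Rightarrow> real) \<mu>. spectral_norm \<Gamma> \<le> \<mu> \<and> (\<forall>b. (\<Sum>x\<in>{x. g x = b}. (\<delta> x)\<^sup>2) = 1) \<and>
    (\<forall>b c. b \<noteq> c \<longrightarrow> (\<Sum>x\<in>{x. g x = b}. \<Sum>y\<in>{y. g y = c}. \<delta> x * \<delta> y * \<Gamma> $ x $ y) = \<mu>)"
proof -
  have sym': "\<Gamma> $ x $ y = \<Gamma> $ y $ x" for x y
    using arg_cong[OF sym, of "\<lambda>M. M $ x $ y"] by (simp add: transpose_def)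
  have ex: "\<exists>x. g x = b" for b
  proof (rule ccontr)
    assume "\<not> (\<exists>x. g x = b)"
    then have "\<Gamma> = 0" using supp by (metis (full_types) vec_eq_iff zero_index)
    then show False using pos by (simp add: spectral_norm_def onorm_zero)
  qed
  define V where "V = (\<lambda>b. {p :: real ^ 'a. \<forall>x. g x \<noteq> b \<longrightarrow> p $ x = 0})"
  define S where "S = (\<lambda>b. sphere 0 1 \<inter> V b)"
  have "closed (V b)" for b
    unfolding V_def by (intro closed_Collect_all closed_Collect_imp closed_Collect_eq continuous_intros) auto
  then have "compact (S False \<times> S True)"
    unfolding S_def by (intro compact_Times compact_Int_closed) auto
  moreover have "S b \<noteq> {}" for b
  proof -
    obtain x where "g x = b" using ex by blast
    then have "axis x 1 \<in> S b" by (auto simp: S_def V_def axis_def norm_axis_1[unfolded axis_def])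
    then show ?thesis by blast
  qed
  moreover have "continuous_on (S False \<times> S True) (\<lambda>(p, q). p \<bullet> (\<Gamma> *v q))"
    unfolding case_prod_beta
    by (intro continuous_intros bounded_linear.continuous_on[OF matrix_vector_mul_bounded_linear])
  ultimately obtain p q where p: "p \<in> S False" and q: "q \<in> S True"
    and max: "\<And>p' q'. p' \<in> S False \<Longrightarrow> q' \<in> S True \<Longrightarrow> p' \<bullet> (\<Gamma> *v q') \<le> p \<bullet> (\<Gamma> *v q)"
    using continuous_attains_sup[of "S False \<times> S True" "\<lambda>(p, q). p \<bullet> (\<Gamma> *v q)"] by fastforce
  define \<mu> where "\<mu> = p \<bullet> (\<Gamma> *v q)"
  \<comment> \<open>\<open>- p\<close> competes in the maximum as well, so
    \<open>- \<mu> \<le> \<mu>\<close>.\<close>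
  have "- p \<in> S False" using p by (auto simp: S_def V_def)
  then have \<mu>0: "0 \<le> \<mu>" using max[of "- p" q] q by (simp add: \<mu>_def)
  have bound: "p' \<bullet> (\<Gamma> *v q') \<le> \<mu> * ((norm p')\<^sup>2 + (norm q')\<^sup>2) / 2"
    if p': "p' \<in> V False" and q': "q' \<in> V True" for p' q'
  proof (cases "p' = 0 \<or> q' = 0")
    case True
    then show ?thesis using \<mu>0 by auto
  next
    case False
    have "((1 / norm p') *\<^sub>R p') \<bullet> (\<Gamma> *v ((1 / norm q') *\<^sub>R q')) \<le> \<mu>"
      unfolding \<mu>_def using p' q' False by (intro max) (auto simp: S_def V_def)
    then have "p' \<bullet> (\<Gamma> *v q') \<le> \<mu> * (norm p' * norm q')"
      using False by (simp add: matrix_vector_mult_scaleR field_simps)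
    also have "\<dots> \<le> \<mu> * (((norm p')\<^sup>2 + (norm q')\<^sup>2) / 2)"
      using sum_squares_bound[of "norm p'" "norm q'"] \<mu>0
      by (intro mult_left_mono) (auto simp: mult.assoc)
    finally show ?thesis by simp
  qed
  define P where "P = (\<lambda>b (w :: real ^ 'a). (\<chi> x. if g x = b then w $ x else 0))"
  have PV: "P b w \<in> V b" for b w by (simp add: P_def V_def)
  have Psplit: "P False w + P True w = w" for w by (auto simp: P_def vec_eq_iff)
  have Pnorm: "(norm w)\<^sup>2 = (norm (P False w))\<^sup>2 + (norm (P True w))\<^sup>2" for w
    unfolding power2_norm_eq_inner inner_vec_def sum.distrib[symmetric]
    by (intro sum.cong) (auto simp: P_def)
  have same: "v \<bullet> (\<Gamma> *v w) = 0" if "v \<in> V b" "w \<in> V b" for v w b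
    unfolding inner_matrix_vector
  proof (intro sum.neutral ballI)
    fix x y
    show "v $ x * w $ y * \<Gamma> $ x $ y = 0"
      using that supp[of x y] by (cases "g x = b"; cases "g y = b") (auto simp: V_def)
  qed
  have swap: "v \<bullet> (\<Gamma> *v w) = w \<bullet> (\<Gamma> *v v)" for v w
    unfolding inner_matrix_vector by (subst sum.swap) (simp add: sym' mult_ac)
  have "spectral_norm \<Gamma> \<le> \<mu>"
    unfolding spectral_norm_le_iff
  proof (intro allI)
    fix v w :: "real ^ 'a"
    \<comment> \<open>The diagonal blocks vanish, and the two off-diagonal blocks are transposes of
      each other, so \<open>bound\<close> covers both surviving terms.\<close>
    have "v \<bullet> (\<Gamma> *v w) = (P False v + P True v) \<bullet> (\<Gamma> *v (P False w + P True w))"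
      by (simp add: Psplit)
    also have "\<dots> = P False v \<bullet> (\<Gamma> *v P True w) + P False w \<bullet> (\<Gamma> *v P True v)"
      using same[OF PV PV] swap[of "P True v" "P False w"]
      by (simp add: matrix_vector_right_distrib inner_add_left inner_add_right)
    also have "\<dots> \<le> \<mu> * ((norm (P False v))\<^sup>2 + (norm (P True w))\<^sup>2) / 2 +
        \<mu> * ((norm (P False w))\<^sup>2 + (norm (P True v))\<^sup>2) / 2"
      by (intro add_mono bound PV)
    also have "\<dots> = \<mu> * ((norm v)\<^sup>2 + (norm w)\<^sup>2) / 2"
      by (simp add: Pnorm[of v] Pnorm[of w] algebra_simps add_divide_distrib)
    finally show "v \<bullet> (\<Gamma> *v w) \<le> \<mu> * ((norm v)\<^sup>2 + (norm w)\<^sup>2) / 2" .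
  qed
  moreover define \<delta> where "\<delta> = (\<lambda>x. if g x then q $ x else p $ x)"
  have "(\<Sum>x\<in>{x. g x = b}. (\<delta> x)\<^sup>2) = 1" for b
  proof -
    define w where "w = (if b then q else p)"
    have "w \<in> S b" using p q by (simp add: w_def)
    then have "1 = (norm w)\<^sup>2" and "w \<in> V b" by (auto simp: S_def)
    then have "1 = (\<Sum>x\<in>UNIV. w $ x * w $ x)"
      by (simp add: power2_norm_eq_inner inner_vec_def)
    also have "\<dots> = (\<Sum>x\<in>{x. g x = b}. w $ x * w $ x)"
      using \<open>w \<in> V b\<close> by (intro sum.mono_neutral_right) (auto simp: V_def)
    also have "\<dots> = (\<Sum>x\<in>{x. g x = b}. (\<delta> x)\<^sup>2)"
      by (intro sum.cong) (auto simp: w_def \<delta>_def power2_eq_square)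
    finally show ?thesis by simp
  qed
  moreover have FT: "(\<Sum>x\<in>{x. g x = False}. \<Sum>y\<in>{y. g y = True}. \<delta> x * \<delta> y * \<Gamma> $ x $ y) = \<mu>"
  proof -
    have "\<mu> = (\<Sum>x\<in>UNIV. \<Sum>y\<in>UNIV. p $ x * q $ y * \<Gamma> $ x $ y)"
      by (simp add: \<mu>_def inner_matrix_vector)
    also have "\<dots> = (\<Sum>x\<in>UNIV. \<Sum>y\<in>{y. g y = True}. p $ x * q $ y * \<Gamma> $ x $ y)"
      using q by (intro sum.cong refl sum.mono_neutral_right) (auto simp: S_def V_def)
    also have "\<dots> = (\<Sum>x\<in>{x. g x = False}. \<Sum>y\<in>{y. g y = True}. p $ x * q $ y * \<Gamma> $ x $ y)"
      using p by (intro sum.mono_neutral_right) (auto simp: S_def V_def)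
    also have "\<dots> = (\<Sum>x\<in>{x. g x = False}. \<Sum>y\<in>{y. g y = True}. \<delta> x * \<delta> y * \<Gamma> $ x $ y)"
      by (intro sum.cong) (auto simp: \<delta>_def)
    finally show ?thesis by simp
  qed
  moreover have "(\<Sum>x\<in>{x. g x = b}. \<Sum>y\<in>{y. g y = c}. \<delta> x * \<delta> y * \<Gamma> $ x $ y) = \<mu>" if "b \<noteq> c" for b c
  proof (cases b)
    case False
    then show ?thesis using that FT by simp
  next
    case True
    then have "c = False" using that by simp
    then show ?thesis
      using True FT by (subst sum.swap) (simp add: sym' mult_ac)
  qed
  ultimately show ?thesis by (intro exI[of _ \<delta>] exI[of _ \<mu>] conjI allI impI)
qed

subsection \<open>Lower bound for compositions\<close>

definition outer :: "(bool ^ 'm::finite \<Rightarrow> bool) \<Rightarrow> bool ^ ('n::finite \<times> 'm) \<Rightarrow> bool ^ 'n" where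
  "outer g x = (\<chi> i. g (block x i))"

lemma outer_nth [simp]: "outer g x $ i = g (block x i)"
  by (simp add: outer_def)

lemma block_nth [simp]: "block x i $ j = x $ (i, j)"
  by (simp add: block_def)

lemma mem_rel_compose: "(x, a) \<in> rel_compose f g \<longleftrightarrow> (outer g x, a) \<in> f"
  by (simp add: rel_compose_def outer_def)

lemma block_inject: "block x = block y \<longleftrightarrow> x = y"
  by (auto simp: fun_eq_iff vec_eq_iff block_def)

text \<open>The blocks of the strings above \<open>z\<close> vary independently, each over a level
  set of \<open>g\<close>; sums of products over a fibre of \<open>outer\<close> therefore
  factor.\<close>

lemma sum_outer:
  fixes g :: "bool ^ 'm::finite \<Rightarrow> bool" and z :: "bool ^ 'n::finite"
  shows "(\<Sum>x\<in>{x. outer g x = z}. F (block x)) = (\<Sum>X\<in>(\<Pi> l\<in>UNIV. {a. g a = z $ l}). F X)"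
proof (rule sum.reindex_bij_betw, rule bij_betw_imageI)
  show "inj_on block {x. outer g x = z}"
    by (auto simp: inj_on_def block_inject)
  show "block ` {x. outer g x = z} = (\<Pi> l\<in>UNIV. {a. g a = z $ l})"
  proof (intro equalityI subsetI)
    fix X assume X: "X \<in> (\<Pi> l\<in>UNIV. {a. g a = z $ l})"
    define x :: "bool ^ ('n \<times> 'm)" where "x = (\<chi> p. X (fst p) $ snd p)"
    have "block x = X" by (auto simp: block_def x_def fun_eq_iff vec_eq_iff)
    moreover have "outer g x = z" using X unfolding vec_eq_iff outer_nth \<open>block x = X\<close> by auto
    ultimately show "X \<in> block ` {x. outer g x = z}" by blast
  qed (auto simp: vec_eq_iff)
qed

lemma sum_prod_Pi:
  fixes F :: "'n::finite \<Rightarrow> 'a \<Rightarrow> real"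
  assumes "\<And>l. finite (S l)"
  shows "(\<Sum>X\<in>(\<Pi> l\<in>UNIV. S l). \<Prod>l\<in>UNIV. F l (X l)) = (\<Prod>l\<in>UNIV. \<Sum>a\<in>S l. F l a)"
  using prod_sum_PiE[of UNIV S F] assms by (simp add: PiE_UNIV_domain)

lemma sum_rotate:
  "(\<Sum>i\<in>A. \<Sum>x\<in>B. \<Sum>y\<in>C. F i x y) = (\<Sum>x\<in>B. \<Sum>y\<in>C. \<Sum>i\<in>A. F i x y)"
  by (subst sum.swap) (intro sum.cong refl sum.swap)

lemma sum_outer_prod:
  fixes g :: "bool ^ 'm::finite \<Rightarrow> bool" and F :: "'n::finite \<Rightarrow> bool ^ 'm \<Rightarrow> real"
  shows "(\<Sum>x\<in>{x. outer g x = z}. \<Prod>l\<in>UNIV. F l (block x l)) = (\<Prod>l\<in>UNIV. \<Sum>a\<in>{a. g a = z $ l}. F l a)"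
  unfolding sum_outer[where F = "\<lambda>X. \<Prod>l\<in>UNIV. F l (X l)"] by (rule sum_prod_Pi) auto

lemma sum_outer_prod2:
  fixes g :: "bool ^ 'm::finite \<Rightarrow> bool" and F :: "'n::finite \<Rightarrow> bool ^ 'm \<Rightarrow> bool ^ 'm \<Rightarrow> real"
  shows "(\<Sum>x\<in>{x. outer g x = z}. \<Sum>y\<in>{y. outer g y = z'}. \<Prod>l\<in>UNIV. F l (block x l) (block y l)) =
    (\<Prod>l\<in>UNIV. \<Sum>a\<in>{a. g a = z $ l}. \<Sum>b\<in>{b. g b = z' $ l}. F l a b)"
  unfolding sum_outer_prod[where F = "\<lambda>l. F l (block _ l)"] by (rule sum_outer_prod)

text \<open>
  Inner products of \<open>pushed\<close> vectors over \<open>z\<close> and \<open>z'\<close> are averages against a kernel such as \<open>\<Psi>\<close> above.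
\<close>

definition pushed ::
  "(bool ^ 'm::finite \<Rightarrow> bool) \<Rightarrow> (bool ^ 'm \<Rightarrow> real) \<Rightarrow> ('n::finite \<Rightarrow> bool ^ 'm \<Rightarrow> 'b \<Rightarrow> real) \<Rightarrow>
   (bool ^ ('n \<times> 'm) \<Rightarrow> real) \<Rightarrow> bool ^ 'n \<Rightarrow> ('n \<Rightarrow> 'b) \<Rightarrow> real" where
  "pushed g \<delta> \<rho> c z w =
     (\<Sum>x\<in>{x. outer g x = z}. (\<Prod>l\<in>UNIV. \<delta> (block x l)) * (\<Prod>l\<in>UNIV. \<rho> l (block x l) (w l)) * c x)"

text \<open>The coordinates \<open>w\<close> are tuples, so the vectors \<open>\<rho>\<close> are
  tensored and the sum over \<open>w\<close> factors into one Gram entry per block.\<close>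

lemma pushed_inner:
  fixes \<rho> :: "'n::finite \<Rightarrow> bool ^ 'm::finite \<Rightarrow> 'b::finite \<Rightarrow> real"
  assumes B: "\<And>l a b. (\<Sum>s\<in>UNIV. \<rho> l a s * \<rho> l b s) = B l a b"
  shows "(\<Sum>w\<in>UNIV. pushed g \<delta> \<rho> c z w * pushed g \<delta> \<rho> c' z' w) =
    (\<Sum>x\<in>{x. outer g x = z}. \<Sum>y\<in>{y. outer g y = z'}.
      (\<Prod>l\<in>UNIV. \<delta> (block x l) * \<delta> (block y l) * B l (block x l) (block y l)) * (c x * c' y))"
proof -
  define t where "t = (\<lambda>x y w. (\<Prod>l\<in>UNIV. \<delta> (block x l) * \<delta> (block y l)) * (c x * c' y) *
      (\<Prod>l\<in>UNIV. \<rho> l (block x l) (w l) * \<rho> l (block y l) (w l)))"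
  have t: "(\<Sum>w\<in>UNIV. t x y w) =
      (\<Prod>l\<in>UNIV. \<delta> (block x l) * \<delta> (block y l) * B l (block x l) (block y l)) * (c x * c' y)" for x y
    using sum_prod_Pi[of "\<lambda>_. UNIV" "\<lambda>l s. \<rho> l (block x l) s * \<rho> l (block y l) s"]
    unfolding t_def sum_distrib_left[symmetric] by (simp add: B prod.distrib)
  have "(\<Sum>w\<in>UNIV. pushed g \<delta> \<rho> c z w * pushed g \<delta> \<rho> c' z' w) =
      (\<Sum>w\<in>UNIV. \<Sum>x\<in>{x. outer g x = z}. \<Sum>y\<in>{y. outer g y = z'}. t x y w)"
    unfolding pushed_def sum_product t_def prod.distrib by (simp add: mult_ac)
  also have "\<dots> = (\<Sum>x\<in>{x. outer g x = z}. \<Sum>y\<in>{y. outer g y = z'}. \<Sum>w\<in>UNIV. t x y w)"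
    by (subst sum.swap) (intro sum.cong refl sum.swap)
  finally show ?thesis unfolding t .
qed

text \<open>Distinct strings above the same \<open>z\<close> differ in some block on which
  \<open>g\<close> agrees, where \<open>B\<close> is 0; only the diagonal survives. Squared norms
  are thus averaged with the product weights of \<open>\<delta>\<close>.\<close>

lemma pushed_norm:
  fixes \<rho> :: "'n::finite \<Rightarrow> bool ^ 'm::finite \<Rightarrow> 'b::finite \<Rightarrow> real"
  assumes B: "\<And>l a b. (\<Sum>s\<in>UNIV. \<rho> l a s * \<rho> l b s) = B l a b"
    and orth: "\<And>l a b. g a = g b \<Longrightarrow> B l a b = (if a = b then 1 else 0)"
  shows "(\<Sum>w\<in>UNIV. (pushed g \<delta> \<rho> c z w)\<^sup>2) =
    (\<Sum>x\<in>{x. outer g x = z}. (\<Prod>l\<in>UNIV. (\<delta> (block x l))\<^sup>2) * (c x)\<^sup>2)"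
proof -
  have "(\<Sum>w\<in>UNIV. (pushed g \<delta> \<rho> c z w)\<^sup>2) =
     (\<Sum>x\<in>{x. outer g x = z}. \<Sum>y\<in>{y. outer g y = z}.
       (\<Prod>l\<in>UNIV. \<delta> (block x l) * \<delta> (block y l) * B l (block x l) (block y l)) * (c x * c y))"
    unfolding power2_eq_square by (rule pushed_inner[OF B])
  also have "\<dots> = (\<Sum>x\<in>{x. outer g x = z}. \<Sum>y\<in>{y. outer g y = z}.
       if y = x then (\<Prod>l\<in>UNIV. (\<delta> (block x l))\<^sup>2) * (c x)\<^sup>2 else 0)"
  proof (intro sum.cong refl)
    fix x y :: "bool ^ ('n \<times> 'm)"
    assume "x \<in> {x. outer g x = z}" "y \<in> {y. outer g y = z}"
    then have same: "g (block x l) = g (block y l)" for l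
      by (auto simp: vec_eq_iff)
    show "(\<Prod>l\<in>UNIV. \<delta> (block x l) * \<delta> (block y l) * B l (block x l) (block y l)) * (c x * c y) =
        (if y = x then (\<Prod>l\<in>UNIV. (\<delta> (block x l))\<^sup>2) * (c x)\<^sup>2 else 0)"
    proof (cases "x = y")
      case True
      then show ?thesis by (simp add: orth power2_eq_square)
    next
      case False
      then obtain l where l: "block x l \<noteq> block y l"
        by (metis block_inject ext)
      have "(\<Prod>l\<in>UNIV. \<delta> (block x l) * \<delta> (block y l) * B l (block x l) (block y l)) = 0"
        using orth[OF same[of l]] l by (intro prod_zero bexI[of _ l]) auto
      then show ?thesis using False by simp
    qed
  qed
  also have "\<dots> = (\<Sum>x\<in>{x. outer g x = z}. (\<Prod>l\<in>UNIV. (\<delta> (block x l))\<^sup>2) * (c x)\<^sup>2)"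
    by (intro sum.cong) simp_all
  finally show ?thesis .
qed

text \<open>Any feasible family and any adversary matrix are allowed, so no optimum has to be
  attained on either side of the final identity.\<close>

lemma ADV_rel_compose_ge:
  fixes f :: "((bool ^ 'n::finite) \<times> 'k::finite) set" and g :: "bool ^ 'm::finite \<Rightarrow> bool"
  assumes feas: "rel_feasible (rel_compose f g) d e u v \<sigma>" and adv: "adversary_matrix g \<Gamma>"
  shows "spectral_norm \<Gamma> * ADV_rel f \<le> rel_cost d u v"
proof (cases "spectral_norm \<Gamma> = 0")
  case True
  then show ?thesis using rel_cost_nonneg[of d u v] by simp
next
  case False
  then have pos: "0 < spectral_norm \<Gamma>"
    using spectral_norm_nonneg[of \<Gamma>] by simp
  have sym: "transpose \<Gamma> = \<Gamma>" and supp: "\<And>x y. g x = g y \<Longrightarrow> \<Gamma> $ x $ y = 0"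
    and had: "\<And>j. spectral_norm (hadamard \<Gamma> (diff_matrix j)) \<le> 1"
    using adv by (auto simp: adversary_matrix_def)
  have "\<exists>(\<delta> :: bool ^ 'm \<Rightarrow> real) \<mu>. spectral_norm \<Gamma> \<le> \<mu> \<and> (\<forall>b. (\<Sum>x\<in>{x. g x = b}. (\<delta> x)\<^sup>2) = 1) \<and>
    (\<forall>b c. b \<noteq> c \<longrightarrow> (\<Sum>x\<in>{x. g x = b}. \<Sum>y\<in>{y. g y = c}. \<delta> x * \<delta> y * \<Gamma> $ x $ y) = \<mu>)"
    by (rule adversary_extremal_weight[OF sym _ pos]) (rule supp)
  then obtain \<delta> :: "bool ^ 'm \<Rightarrow> real" and \<mu> where extremal:
    "spectral_norm \<Gamma> \<le> \<mu> \<and> (\<forall>b. (\<Sum>x\<in>{x. g x = b}. (\<delta> x)\<^sup>2) = 1) \<and>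
    (\<forall>b c. b \<noteq> c \<longrightarrow> (\<Sum>x\<in>{x. g x = b}. \<Sum>y\<in>{y. g y = c}. \<delta> x * \<delta> y * \<Gamma> $ x $ y) = \<mu>)"
    by (elim exE) (rule that)
  note \<mu> = extremal[THEN conjunct1]
    and unit = extremal[THEN conjunct2, THEN conjunct1, rule_format]
    and cross = extremal[THEN conjunct2, THEN conjunct2, rule_format]
  have \<mu>0: "0 < \<mu>" using pos \<mu> by simp
  obtain r :: "bool ^ 'm \<Rightarrow> bool ^ 'm \<Rightarrow> real" where
    r: "\<And>a b. (\<Sum>s\<in>UNIV. r a s * r b s) = (if a = b then 1 else 0) + \<Gamma> $ a $ b / \<mu>"
    using gram_identity_plus[OF sym \<mu> \<mu>0] by blast
  have "transpose (hadamard \<Gamma> (diff_matrix j)) = hadamard \<Gamma> (diff_matrix j)" for j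
  proof -
    have "\<Gamma> $ y $ x = \<Gamma> $ x $ y" for x y
      using arg_cong[OF sym, of "\<lambda>M. M $ x $ y"] by (simp add: transpose_def)
    then show ?thesis by (auto simp: transpose_def hadamard_def diff_matrix_def vec_eq_iff)
  qed
  then have "\<exists>q :: bool ^ 'm \<Rightarrow> bool ^ 'm \<Rightarrow> real. \<forall>a b.
      (\<Sum>s\<in>UNIV. q a s * q b s) = (if a = b then 1 else 0) + hadamard \<Gamma> (diff_matrix j) $ a $ b / 1" for j
    by (rule gram_identity_plus[OF _ had]) simp
  then obtain q :: "'m \<Rightarrow> bool ^ 'm \<Rightarrow> bool ^ 'm \<Rightarrow> real" where
    q: "\<And>j a b. (\<Sum>s\<in>UNIV. q j a s * q j b s) = (if a = b then 1 else 0) + hadamard \<Gamma> (diff_matrix j) $ a $ b"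
    unfolding div_by_1 by metis
  define A where "A = (\<lambda>a b. (if a = b then 1 else 0) + \<Gamma> $ a $ b / \<mu>)"
  \<comment> \<open>A query to bit \<open>j\<close> of block \<open>i\<close> replaces the factor of
    that block; all other blocks keep the vectors of \<open>A\<close>.\<close>
  define \<rho> where "\<rho> = (\<lambda>i j l. if l = (i::'n) then q j else r)"
  define B where "B = (\<lambda>i j l a b. if l = (i::'n) then (if a = b then 1 else 0) + hadamard \<Gamma> (diff_matrix j) $ a $ b else A a b)"
  have \<rho>: "(\<Sum>s\<in>UNIV. \<rho> i j l a s * \<rho> i j l b s) = B i j l a b" for i j l a b
    by (simp add: \<rho>_def B_def q r A_def)
  have A_same: "A a b = (if a = b then 1 else 0)" if "g a = g b" for a b
    using supp[OF that] by (simp add: A_def)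
  have B_same: "B i j l a b = (if a = b then 1 else 0)" if "g a = g b" for i j l a b
    using supp[OF that] A_same[OF that] by (cases "a = b") (auto simp: B_def hadamard_def)
  have weight: "(\<Sum>x\<in>{x. outer g x = z}. \<Prod>l\<in>UNIV. (\<delta> (block x l))\<^sup>2) = 1" for z :: "bool ^ 'n"
    unfolding sum_outer_prod[where F = "\<lambda>l a. (\<delta> a)\<^sup>2"] unit by simp
  \<comment> \<open>For equal values this is the unit norm of \<open>\<delta>\<close>; for different
    values it is the extremality of \<open>\<delta>\<close>, divided by
    \<open>\<mu>\<close>.\<close>
  have "(\<Sum>a\<in>{a. g a = b}. \<Sum>a'\<in>{a. g a = b'}. \<delta> a * \<delta> a' * A a a') = 1" for b b'
  proof (cases "b = b'")
    case True
    have "(\<Sum>a\<in>{a. g a = b}. \<Sum>a'\<in>{a. g a = b'}. \<delta> a * \<delta> a' * A a a') =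
        (\<Sum>a\<in>{a. g a = b}. \<Sum>a'\<in>{a. g a = b}. if a' = a then (\<delta> a)\<^sup>2 else 0)"
      using True by (intro sum.cong) (auto simp: A_same power2_eq_square)
    also have "\<dots> = (\<Sum>a\<in>{a. g a = b}. (\<delta> a)\<^sup>2)"
      by (intro sum.cong) simp_all
    finally show ?thesis by (simp add: unit)
  next
    case False
    then have "(\<Sum>a\<in>{a. g a = b}. \<Sum>a'\<in>{a. g a = b'}. \<delta> a * \<delta> a' * A a a') =
        (\<Sum>a\<in>{a. g a = b}. \<Sum>a'\<in>{a. g a = b'}. \<delta> a * \<delta> a' * \<Gamma> $ a $ a' / \<mu>)"
      by (intro sum.cong) (auto simp: A_def)
    also have "\<dots> = 1"
      using cross[OF False] \<mu>0 by (simp add: sum_divide_distrib[symmetric])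
    finally show ?thesis .
  qed
  then have weightA: "(\<Sum>x\<in>{x. outer g x = z}. \<Sum>y\<in>{y. outer g y = z'}.
      \<Prod>l\<in>UNIV. \<delta> (block x l) * \<delta> (block y l) * A (block x l) (block y l)) = 1" for z z' :: "bool ^ 'n"
    unfolding sum_outer_prod2[where F = "\<lambda>l a b. \<delta> a * \<delta> b * A a b"] by simp
  define \<Psi> where "\<Psi> = (\<lambda>x y. \<Prod>l\<in>(UNIV::'n set). \<delta> (block x l) * \<delta> (block y l) * A (block x l) (block y l))"
  \<comment> \<open>Different \<open>g\<close>-values force different blocks, so the identity part
    is absent and \<open>B / \<mu>\<close> is \<open>A\<close> masked to pairs that differ at bit
    \<open>j\<close>.\<close>
  have B_prod: "(\<Prod>l\<in>UNIV. \<delta> (block x l) * \<delta> (block y l) * B i j l (block x l) (block y l)) / \<mu> =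
      (if x $ (i, j) \<noteq> y $ (i, j) then \<Psi> x y else 0)" if "g (block x i) \<noteq> g (block y i)" for x y i j
  proof -
    have "B i j i (block x i) (block y i) / \<mu> = (if x $ (i, j) \<noteq> y $ (i, j) then A (block x i) (block y i) else 0)"
      using that by (auto simp: B_def A_def hadamard_def diff_matrix_def)
    moreover have "(\<Prod>l\<in>UNIV. \<delta> (block x l) * \<delta> (block y l) * B i j l (block x l) (block y l)) =
        \<delta> (block x i) * \<delta> (block y i) * B i j i (block x i) (block y i) *
        (\<Prod>l\<in>UNIV - {i}. \<delta> (block x l) * \<delta> (block y l) * A (block x l) (block y l))"
      by (subst prod.remove[of UNIV i]) (auto simp: B_def intro!: arg_cong2[of _ _ _ _ "(*)"] prod.cong)
    moreover have "\<Psi> x y = \<delta> (block x i) * \<delta> (block y i) * A (block x i) (block y i) *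
        (\<Prod>l\<in>UNIV - {i}. \<delta> (block x l) * \<delta> (block y l) * A (block x l) (block y l))"
      unfolding \<Psi>_def by (subst prod.remove[of UNIV i]) auto
    ultimately show ?thesis using \<mu>0 by (auto simp: field_simps)
  qed
  \<comment> \<open>Distinct blocks of equal \<open>g\<close>-value are orthogonal under
    \<open>A\<close>. Hence queries to blocks where \<open>z\<close> and \<open>z'\<close> agree
    carry no weight, and the sum over differing positions of \<open>z\<close> and \<open>z'\<close>
    extends to all positions.\<close>
  have A_zero: "\<Psi> x y = 0" if "g (block x i) = g (block y i)" "x $ (i, j) \<noteq> y $ (i, j)" for x y i j
    unfolding \<Psi>_def
  proof (rule prod_zero)
    have "block x i \<noteq> block y i" using that(2) by (metis block_nth)
    then show "\<exists>l\<in>UNIV. \<delta> (block x l) * \<delta> (block y l) * A (block x l) (block y l) = 0"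
      using A_same[OF that(1)] by (intro bexI[of _ i]) auto
  qed simp
  define I where "I = (UNIV :: 'm set) \<times> (UNIV :: ('n \<Rightarrow> bool ^ 'm) set) \<times> {..<d}"
  define J where "J = (UNIV :: ('n \<Rightarrow> bool ^ 'm) set) \<times> {..<e}"
  \<comment> \<open>\<open>u\<close> and \<open>v\<close> each receive
    \<open>1 / sqrt \<mu>\<close>: the inner products are divided by \<open>\<mu>\<close>, as
    \<open>B_prod\<close> requires, and so are both costs.\<close>
  define push where "push = (\<lambda>w z i (j, t, k :: nat). pushed g \<delta> (\<rho> i j) (\<lambda>x. w x (i, j) k) z t / sqrt \<mu>)"
  define \<sigma>' where "\<sigma>' = (\<lambda>z a (t, k :: nat). if k < e then pushed g \<delta> (\<lambda>_. r) (\<lambda>x. \<sigma> x a k) z t else 0)"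
  have sumI: "(\<Sum>k\<in>I. F k) = (\<Sum>j\<in>UNIV. \<Sum>k<d. \<Sum>t\<in>UNIV. F (j, t, k))" for F :: "_ \<Rightarrow> real"
    unfolding I_def sum.cartesian_product' by (intro sum.cong refl sum.swap)
  have sumJ: "(\<Sum>k\<in>J. F k) = (\<Sum>k<e. \<Sum>t\<in>UNIV. F (t, k))" for F :: "_ \<Rightarrow> real"
    unfolding J_def sum.cartesian_product' by (rule sum.swap)
  have "\<exists>d' e' u' v' \<sigma>'. rel_feasible f d' e' u' v' \<sigma>' \<and> rel_cost d' u' v' \<le> rel_cost d u v / \<mu>"
  proof (rule rel_feasible_of_indexed[where I = I and J = J and u = "push u" and v = "push v" and \<sigma> = \<sigma>'])
    show "finite I" "finite J" by (simp_all add: I_def J_def)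
  next
    fix z a k assume "(z, a) \<notin> f"
    then have "\<sigma> x a k = 0" if "outer g x = z" "k < e" for x k
      using feas that by (auto simp: rel_feasible_def mem_rel_compose)
    then show "\<sigma>' z a k = 0"
      by (auto simp: \<sigma>'_def pushed_def case_prod_beta intro!: sum.neutral)
  next
    \<comment> \<open>By \<open>pushed_norm\<close> the cost at \<open>z\<close> is an average of
      costs at strings above \<open>z\<close>, with total weight 1, divided by \<open>\<mu>\<close>.
      An arbitrary \<open>w\<close> serves for both \<open>u\<close> and \<open>v\<close>.\<close>
    have cost: "(\<Sum>i\<in>UNIV. \<Sum>k\<in>I. (push w z i k)\<^sup>2) \<le> W / \<mu>"
      if w: "\<And>x. (\<Sum>i\<in>UNIV. dot d (w x i) (w x i)) \<le> W" for w z W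
    proof -
      have "(\<Sum>i\<in>UNIV. \<Sum>k\<in>I. (push w z i k)\<^sup>2) =
          (\<Sum>i\<in>UNIV. \<Sum>j\<in>UNIV. \<Sum>k<d. (\<Sum>x\<in>{x. outer g x = z}. (\<Prod>l\<in>UNIV. (\<delta> (block x l))\<^sup>2) * (w x (i, j) k)\<^sup>2) / \<mu>)"
        using \<mu>0 by (simp add: sumI push_def power_divide sum_divide_distrib[symmetric] pushed_norm[OF \<rho> B_same])
      also have "\<dots> = (\<Sum>x\<in>{x. outer g x = z}. (\<Prod>l\<in>UNIV. (\<delta> (block x l))\<^sup>2) *
          (\<Sum>i\<in>UNIV. \<Sum>j\<in>UNIV. dot d (w x (i, j)) (w x (i, j)))) / \<mu>"
        unfolding dot_def sum_distrib_left sum_divide_distrib[symmetric] power2_eq_square[of "w _ _ _"]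
        by (simp only: sum.swap[of _ _ "{x. outer g x = z}"])
      also have "\<dots> \<le> (\<Sum>x\<in>{x. outer g x = z}. (\<Prod>l\<in>UNIV. (\<delta> (block x l))\<^sup>2) * W) / \<mu>"
      proof (intro divide_right_mono sum_mono mult_left_mono)
        fix x
        show "(\<Sum>i\<in>UNIV. \<Sum>j\<in>UNIV. dot d (w x (i, j)) (w x (i, j))) \<le> W"
          using w[of x] by (simp add: sum.cartesian_product)
      qed (use \<mu>0 in \<open>auto intro: prod_nonneg\<close>)
      also have "\<dots> = W / \<mu>"
        by (simp add: sum_distrib_right[symmetric] weight)
      finally show ?thesis .
    qed
    fix z
    \<comment> \<open>Unfolded by \<open>rel_cost_le_iff\<close>, this reflexive inequality yields
      the bounds at each single input.\<close>
    have "rel_cost d u v \<le> rel_cost d u v" by simp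
    then show "(\<Sum>i\<in>UNIV. \<Sum>k\<in>I. (push u z i k)\<^sup>2) \<le> rel_cost d u v / \<mu>"
      and "(\<Sum>i\<in>UNIV. \<Sum>k\<in>I. (push v z i k)\<^sup>2) \<le> rel_cost d u v / \<mu>"
      unfolding rel_cost_le_iff by (auto intro: cost)
  next
    fix z z' :: "bool ^ 'n"
    let ?Z = "{x. outer g x = z}" and ?Z' = "{y. outer g y = z'}"
    have \<sigma>\<sigma>: "(\<Sum>a\<in>UNIV. \<Sum>k\<in>J. \<sigma>' z a k * \<sigma>' z' a k) =
        (\<Sum>x\<in>?Z. \<Sum>y\<in>?Z'. \<Psi> x y * (\<Sum>a\<in>UNIV. dot e (\<sigma> x a) (\<sigma> y a)))"
    proof -
      have "(\<Sum>a\<in>UNIV. \<Sum>k\<in>J. \<sigma>' z a k * \<sigma>' z' a k) =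
          (\<Sum>a\<in>UNIV. \<Sum>k<e. \<Sum>x\<in>?Z. \<Sum>y\<in>?Z'. \<Psi> x y * (\<sigma> x a k * \<sigma> y a k))"
        by (simp add: sumJ \<sigma>'_def pushed_inner[OF r] \<Psi>_def A_def)
      also have "\<dots> = (\<Sum>x\<in>?Z. \<Sum>y\<in>?Z'. \<Psi> x y * (\<Sum>a\<in>UNIV. dot e (\<sigma> x a) (\<sigma> y a)))"
        unfolding dot_def sum_distrib_left
        by (simp only: sum_rotate[where B = ?Z and C = ?Z'])
      finally show ?thesis .
    qed
    have uv: "(\<Sum>k\<in>I. push u z i k * push v z' i k) =
        (\<Sum>x\<in>?Z. \<Sum>y\<in>?Z'. \<Sum>j\<in>UNIV. (if x $ (i, j) \<noteq> y $ (i, j) then \<Psi> x y * dot d (u x (i, j)) (v y (i, j)) else 0))"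
      if "z $ i \<noteq> z' $ i" for i
    proof -
      have "(\<Sum>k\<in>I. push u z i k * push v z' i k) =
          (\<Sum>j\<in>UNIV. \<Sum>k<d. \<Sum>x\<in>?Z. \<Sum>y\<in>?Z'.
            (\<Prod>l\<in>UNIV. \<delta> (block x l) * \<delta> (block y l) * B i j l (block x l) (block y l)) / \<mu> *
            (u x (i, j) k * v y (i, j) k))"
        using \<mu>0 by (simp add: sumI push_def sum_divide_distrib[symmetric] pushed_inner[OF \<rho>])
      also have "\<dots> = (\<Sum>j\<in>UNIV. \<Sum>k<d. \<Sum>x\<in>?Z. \<Sum>y\<in>?Z'.
            (if x $ (i, j) \<noteq> y $ (i, j) then \<Psi> x y else 0) * (u x (i, j) k * v y (i, j) k))"
      proof (intro sum.cong refl)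
        fix j k x y assume "x \<in> ?Z" "y \<in> ?Z'"
        then have "g (block x i) \<noteq> g (block y i)" using that by auto
        from B_prod[OF this, of j] show "(\<Prod>l\<in>UNIV. \<delta> (block x l) * \<delta> (block y l) * B i j l (block x l) (block y l)) / \<mu> *
            (u x (i, j) k * v y (i, j) k) =
            (if x $ (i, j) \<noteq> y $ (i, j) then \<Psi> x y else 0) * (u x (i, j) k * v y (i, j) k)"
          by (simp only:)
      qed
      also have "\<dots> = (\<Sum>x\<in>?Z. \<Sum>y\<in>?Z'. \<Sum>j\<in>UNIV. \<Sum>k<d.
            (if x $ (i, j) \<noteq> y $ (i, j) then \<Psi> x y else 0) * (u x (i, j) k * v y (i, j) k))"
        by (simp only: sum_rotate[where B = ?Z and C = ?Z'])
      also have "\<dots> = (\<Sum>x\<in>?Z. \<Sum>y\<in>?Z'. \<Sum>j\<in>UNIV.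
          (if x $ (i, j) \<noteq> y $ (i, j) then \<Psi> x y * dot d (u x (i, j)) (v y (i, j)) else 0))"
        unfolding dot_def sum_distrib_left by (intro sum.cong refl) simp
      finally show ?thesis .
    qed
    have "(\<Sum>i\<in>{i. z $ i \<noteq> z' $ i}. \<Sum>k\<in>I. push u z i k * push v z' i k) =
        (\<Sum>i\<in>{i. z $ i \<noteq> z' $ i}. \<Sum>x\<in>?Z. \<Sum>y\<in>?Z'. \<Sum>j\<in>UNIV.
          (if x $ (i, j) \<noteq> y $ (i, j) then \<Psi> x y * dot d (u x (i, j)) (v y (i, j)) else 0))"
      using uv by (intro sum.cong) auto
    also have "\<dots> = (\<Sum>i\<in>UNIV. \<Sum>x\<in>?Z. \<Sum>y\<in>?Z'. \<Sum>j\<in>UNIV.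
          (if x $ (i, j) \<noteq> y $ (i, j) then \<Psi> x y * dot d (u x (i, j)) (v y (i, j)) else 0))"
    proof (intro sum.mono_neutral_left ballI sum.neutral)
      fix i x y j assume "i \<in> UNIV - {i. z $ i \<noteq> z' $ i}" "x \<in> ?Z" "y \<in> ?Z'"
      then have "g (block x i) = g (block y i)" by auto
      then show "(if x $ (i, j) \<noteq> y $ (i, j) then \<Psi> x y * dot d (u x (i, j)) (v y (i, j)) else 0) = 0"
        using A_zero[of x i y j] by simp
    qed auto
    also have "\<dots> = (\<Sum>x\<in>?Z. \<Sum>y\<in>?Z'. \<Sum>i\<in>UNIV. \<Sum>j\<in>UNIV.
          (if x $ (i, j) \<noteq> y $ (i, j) then \<Psi> x y * dot d (u x (i, j)) (v y (i, j)) else 0))"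
      by (simp only: sum_rotate[where B = ?Z and C = ?Z'])
    also have "\<dots> = (\<Sum>x\<in>?Z. \<Sum>y\<in>?Z'. \<Psi> x y * (\<Sum>p\<in>{p. x $ p \<noteq> y $ p}. dot d (u x p) (v y p)))"
    proof (intro sum.cong refl)
      fix x y
      have "(\<Sum>p\<in>{p. x $ p \<noteq> y $ p}. dot d (u x p) (v y p)) =
          (\<Sum>p\<in>UNIV. if x $ p \<noteq> y $ p then dot d (u x p) (v y p) else 0)"
        by (simp add: sum.If_cases)
      also have "\<dots> = (\<Sum>i\<in>UNIV. \<Sum>j\<in>UNIV. if x $ (i, j) \<noteq> y $ (i, j) then dot d (u x (i, j)) (v y (i, j)) else 0)"
        by (simp add: sum.cartesian_product)
      finally show "(\<Sum>i\<in>UNIV. \<Sum>j\<in>UNIV.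
          (if x $ (i, j) \<noteq> y $ (i, j) then \<Psi> x y * dot d (u x (i, j)) (v y (i, j)) else 0)) =
          \<Psi> x y * (\<Sum>p\<in>{p. x $ p \<noteq> y $ p}. dot d (u x p) (v y p))"
        by (auto simp: sum_distrib_left intro!: sum.cong)
    qed
    \<comment> \<open>The constraint of the given family holds for each pair \<open>x\<close>,
      \<open>y\<close>; summing it against \<open>\<Psi>\<close>, of total weight 1, leaves the
      constraint for \<open>z\<close>, \<open>z'\<close>.\<close>
    also have "\<dots> = (\<Sum>x\<in>?Z. \<Sum>y\<in>?Z'. \<Psi> x y - \<Psi> x y * (\<Sum>a\<in>UNIV. dot e (\<sigma> x a) (\<sigma> y a)))"
    proof -
      have "(\<Sum>p\<in>{p. x $ p \<noteq> y $ p}. dot d (u x p) (v y p)) = 1 - (\<Sum>a\<in>UNIV. dot e (\<sigma> x a) (\<sigma> y a))" for x y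
        using feas by (simp add: rel_feasible_def)
      then show ?thesis by (simp add: right_diff_distrib)
    qed
    also have "\<dots> = 1 - (\<Sum>a\<in>UNIV. \<Sum>k\<in>J. \<sigma>' z a k * \<sigma>' z' a k)"
      using weightA[where z = z and z' = z'] by (simp add: \<sigma>\<sigma> sum_subtractf \<Psi>_def)
    finally show "(\<Sum>i\<in>{i. z $ i \<noteq> z' $ i}. \<Sum>k\<in>I. push u z i k * push v z' i k) =
        1 - (\<Sum>a\<in>UNIV. \<Sum>k\<in>J. \<sigma>' z a k * \<sigma>' z' a k)" .
  qed
  then have "ADV_rel f \<le> rel_cost d u v / \<mu>"
    using ADV_rel_le_cost order_trans by blast
  then have "spectral_norm \<Gamma> * ADV_rel f \<le> spectral_norm \<Gamma> * (rel_cost d u v / \<mu>)"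
    using pos by (intro mult_left_mono) auto
  also have "\<dots> \<le> \<mu> * (rel_cost d u v / \<mu>)"
    using \<mu> \<mu>0 rel_cost_nonneg[of d u v] by (intro mult_right_mono) auto
  finally show ?thesis using \<mu>0 by simp
qed

subsection \<open>Duality for the functional bound\<close>

text \<open>Polarisation turns the bilinear form into a difference of quadratic ones, and the
  parallelogram law adds up their bounds.\<close>

lemma spectral_norm_le_quadratic:
  fixes A :: "real ^ 'a::finite ^ 'a"
  assumes sym: "transpose A = A" and quad: "\<And>w. \<bar>w \<bullet> (A *v w)\<bar> \<le> \<mu> * (norm w)\<^sup>2"
  shows "spectral_norm A \<le> \<mu>"
  unfolding spectral_norm_le_iff
proof (intro allI)
  fix v w :: "real ^ 'a"
  have "w \<bullet> (A *v v) = v \<bullet> (A *v w)"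
    using dot_lmul_matrix[of w A v] sym by (metis inner_commute transpose_matrix_vector)
  then have "4 * (v \<bullet> (A *v w)) = (v + w) \<bullet> (A *v (v + w)) - (v - w) \<bullet> (A *v (v - w))"
    by (simp add: matrix_vector_right_distrib matrix_vector_mult_diff_distrib inner_add_left
        inner_add_right inner_diff_left inner_diff_right)
  also have "\<dots> \<le> \<mu> * (norm (v + w))\<^sup>2 + \<mu> * (norm (v - w))\<^sup>2"
    using quad[of "v + w"] quad[of "v - w"] by linarith
  also have "\<dots> = 2 * \<mu> * ((norm v)\<^sup>2 + (norm w)\<^sup>2)"
    by (simp add: power2_norm_eq_inner inner_add_left inner_add_right inner_diff_left inner_diff_right
        inner_commute algebra_simps)
  finally show "v \<bullet> (A *v w) \<le> \<mu> * ((norm v)\<^sup>2 + (norm w)\<^sup>2) / 2" by simp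
qed

lemma abs_component_le_spectral_norm:
  fixes A :: "real ^ 'b::finite ^ 'a::finite"
  shows "\<bar>A $ x $ y\<bar> \<le> spectral_norm A"
proof -
  have "\<bar>A $ x $ y\<bar> = \<bar>(A *v axis y 1) $ x\<bar>"
    by (simp add: matrix_vector_mult_basis column_def)
  also have "\<dots> \<le> norm (A *v axis y 1)"
    by (rule component_le_norm_cart)
  also have "\<dots> \<le> spectral_norm A"
    using norm_le_spectral_norm[of A "axis y 1"] by simp
  finally show ?thesis .
qed

text \<open>The supremum needs a bounded set: inputs with different \<open>g\<close>-values differ
  at some bit \<open>j\<close>, and there the entry of \<open>\<Gamma>\<close> is one of the
  Hadamard product, hence at most 1 in absolute value.\<close>

lemma spectral_norm_le_ADV:
  assumes "adversary_matrix g \<Gamma>"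
  shows "spectral_norm \<Gamma> \<le> ADV g"
  unfolding ADV_def
proof (rule cSup_upper)
  show "bdd_above {spectral_norm \<Gamma> | \<Gamma>. adversary_matrix g \<Gamma>}"
  proof (rule bdd_aboveI)
    fix s assume "s \<in> {spectral_norm \<Gamma> | \<Gamma>. adversary_matrix g \<Gamma>}"
    then obtain \<Gamma> where s: "s = spectral_norm \<Gamma>" and \<Gamma>: "adversary_matrix g \<Gamma>" by blast
    have "\<bar>\<Gamma> $ x $ y\<bar> \<le> 1" for x y
    proof (cases "g x = g y")
      case True
      then show ?thesis using \<Gamma> by (simp add: adversary_matrix_def)
    next
      case False
      then have "x \<noteq> y" by auto
      then obtain j where "x $ j \<noteq> y $ j" unfolding vec_eq_iff by blast
      then have "\<Gamma> $ x $ y = hadamard \<Gamma> (diff_matrix j) $ x $ y"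
        by (simp add: hadamard_def diff_matrix_def)
      then show ?thesis
        using abs_component_le_spectral_norm[of "hadamard \<Gamma> (diff_matrix j)" x y] \<Gamma>
        unfolding adversary_matrix_def by (metis order_trans)
    qed
    then show "s \<le> real CARD(bool ^ 'a) * real CARD(bool ^ 'a) * 1"
      unfolding s spectral_norm_def by (rule onorm_le_matrix_component)
  qed
qed (use assms in blast)

lemma adversary_matrix_0: "adversary_matrix (g :: bool ^ 'm::finite \<Rightarrow> bool) 0"
proof -
  have "hadamard (0 :: real ^ (bool ^ 'm) ^ (bool ^ 'm)) B = 0" for B
    by (simp add: hadamard_def vec_eq_iff)
  moreover have "spectral_norm (0 :: real ^ (bool ^ 'm) ^ (bool ^ 'm)) = 0"
    by (simp add: spectral_norm_def onorm_zero)
  moreover have "transpose (0 :: real ^ (bool ^ 'm) ^ (bool ^ 'm)) = 0"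
    by (simp add: transpose_def vec_eq_iff)
  ultimately show ?thesis
    by (simp add: adversary_matrix_def)
qed

lemma ADV_nonneg: "0 \<le> ADV g"
  using spectral_norm_le_ADV[OF adversary_matrix_0] spectral_norm_nonneg order_trans by blast

text \<open>If no such \<open>X\<close> exists, a hyperplane separates the target from the cone of
  attainable values. Its coefficients, symmetrised and rescaled, form an adversary matrix of norm at
  least \<open>W\<close>. Weak separation is enough because \<open>W\<close> exceeds
  \<open>ADV g\<close> strictly.\<close>

lemma ADV_dual:
  fixes g :: "bool ^ 'm::finite \<Rightarrow> bool"
  assumes W: "ADV g < W"
  shows "\<exists>X :: 'm \<Rightarrow> bool ^ 'm \<Rightarrow> bool ^ 'm \<Rightarrow> real.
    (\<forall>j a b. X j a b = X j b a) \<and> (\<forall>j c. 0 \<le> (\<Sum>a\<in>UNIV. \<Sum>b\<in>UNIV. c a * c b * X j a b)) \<and>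
    (\<forall>x y. \<not> g x \<and> g y \<longrightarrow> (\<Sum>j\<in>{j. x $ j \<noteq> y $ j}. X j x y) = 1) \<and>
    (\<forall>x. (\<Sum>j\<in>UNIV. X j x x) \<le> W)"
proof (rule ccontr)
  assume infeasible: "\<not> ?thesis"
  \<comment> \<open>In the cone \<open>S\<close>, the entries \<open>M $ x $ y\<close> with not \<open>\<not> g x \<and> g y\<close> are free, which forces the separating functional to vanish there.\<close>
  define psd where "psd = (\<lambda>X :: 'm \<Rightarrow> bool ^ 'm \<Rightarrow> bool ^ 'm \<Rightarrow> real.
    (\<forall>j a b. X j a b = X j b a) \<and> (\<forall>j c. 0 \<le> (\<Sum>a\<in>UNIV. \<Sum>b\<in>UNIV. c a * c b * X j a b)))"
  define attains where "attains = (\<lambda>(M :: real ^ (bool ^ 'm) ^ (bool ^ 'm), D :: real ^ (bool ^ 'm)) X.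
    (\<forall>x y. \<not> g x \<and> g y \<longrightarrow> M $ x $ y = (\<Sum>j\<in>{j. x $ j \<noteq> y $ j}. X j x y)) \<and>
    (\<forall>x. (\<Sum>j\<in>UNIV. X j x x) \<le> D $ x))"
  define S where "S = {s. \<exists>X. psd X \<and> attains s X}"
  define target where "target = ((\<chi> x y. 1) :: real ^ (bool ^ 'm) ^ (bool ^ 'm), (\<chi> x. W) :: real ^ (bool ^ 'm))"
  have "target \<notin> S"
    using infeasible unfolding S_def target_def psd_def attains_def by simp
  have scale: "t *\<^sub>R s \<in> S" if s: "s \<in> S" and t: "0 \<le> t" for s t
  proof -
    obtain X where X: "psd X" "attains s X" using s by (auto simp: S_def)
    define Y where "Y = (\<lambda>j a b. t * X j a b)"
    have "(\<Sum>a\<in>UNIV. \<Sum>b\<in>UNIV. c a * c b * Y j a b) = t * (\<Sum>a\<in>UNIV. \<Sum>b\<in>UNIV. c a * c b * X j a b)" for j c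
      by (simp add: Y_def sum_distrib_left mult_ac)
    then have "psd Y" using X(1) t by (auto simp: psd_def) (simp_all add: Y_def)
    moreover have "attains (t *\<^sub>R s) Y"
      using X(2) t by (auto simp: attains_def Y_def sum_distrib_left[symmetric] case_prod_beta intro: mult_left_mono)
    ultimately show ?thesis by (auto simp: S_def)
  qed
  have add: "s + s' \<in> S" if s: "s \<in> S" and s': "s' \<in> S" for s s'
  proof -
    obtain X X' where X: "psd X" "attains s X" and X': "psd X'" "attains s' X'"
      using s s' by (auto simp: S_def)
    define Y where "Y = (\<lambda>j a b. X j a b + X' j a b)"
    have "(\<Sum>a\<in>UNIV. \<Sum>b\<in>UNIV. c a * c b * Y j a b) = (\<Sum>a\<in>UNIV. \<Sum>b\<in>UNIV. c a * c b * X j a b) +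
       (\<Sum>a\<in>UNIV. \<Sum>b\<in>UNIV. c a * c b * X' j a b)" for j c
      by (simp add: Y_def sum.distrib distrib_left)
    then have "psd Y" using X(1) X'(1) by (auto simp: psd_def) (simp_all add: Y_def)
    moreover have "attains (s + s') Y"
      using X(2) X'(2) by (auto simp: attains_def Y_def sum.distrib case_prod_beta intro: add_mono)
    ultimately show ?thesis by (auto simp: S_def)
  qed
  \<comment> \<open>Reached by \<open>X = 0\<close>; these points later fix the support of
    \<open>G\<close> and the sign of \<open>\<beta>\<close>.\<close>
  have pureS: "(M, D) \<in> S"
    if "\<And>x y. \<not> g x \<Longrightarrow> g y \<Longrightarrow> M $ x $ y = 0" "\<And>x. 0 \<le> D $ x" for M D
    unfolding S_def using that by (auto simp: psd_def attains_def intro!: exI[of _ "\<lambda>_ _ _. 0"])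
  \<comment> \<open>A rank-one matrix placed at the single coordinate \<open>j\<close>; it tests the
    norm constraint for bit \<open>j\<close>.\<close>
  have rankS: "((\<chi> x y. if x $ j \<noteq> y $ j then c x * c y else 0), (\<chi> x. (c x)\<^sup>2)) \<in> S" for j c
  proof -
    define X where "X = (\<lambda>i a b. if i = j then c a * c b else (0::real))"
    have "(\<Sum>a\<in>UNIV. \<Sum>b\<in>UNIV. h a * h b * X i a b) = (if i = j then (\<Sum>a\<in>UNIV. h a * c a) * (\<Sum>a\<in>UNIV. h a * c a) else 0)" for i h
      unfolding sum_product by (simp add: X_def mult_ac)
    then have "psd X" by (simp add: psd_def) (simp add: X_def)
    moreover have "attains ((\<chi> x y. if x $ j \<noteq> y $ j then c x * c y else 0), (\<chi> x. (c x)\<^sup>2)) X"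
      by (auto simp: attains_def X_def power2_eq_square)
    ultimately show ?thesis by (auto simp: S_def)
  qed
  have "convex S"
    by (rule convexI) (intro add scale)
  moreover have "S \<noteq> {}" using pureS[of 0 0] by auto
  ultimately have "\<exists>h b. h \<noteq> 0 \<and> (\<forall>s\<in>S. h \<bullet> s \<le> b) \<and> (\<forall>s\<in>{target}. b \<le> h \<bullet> s)"
    using \<open>target \<notin> S\<close> by (intro separating_hyperplane_sets) auto
  then obtain h b where h: "h \<noteq> 0" and hS: "\<And>s. s \<in> S \<Longrightarrow> h \<bullet> s \<le> b" and ht: "b \<le> h \<bullet> target"
    by blast
  have "0 \<le> b" using hS[of "(0, 0)"] pureS[of 0 0] by (simp add: zero_prod_def[symmetric])
  \<comment> \<open>A functional bounded above on a set closed under nonnegative scaling is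
    nonpositive there; the factor chosen would give the value \<open>b + 1\<close>.\<close>
  have cone: "h \<bullet> s \<le> 0" if s: "s \<in> S" for s
  proof (rule ccontr)
    assume "\<not> h \<bullet> s \<le> 0"
    then show False
      using hS[OF scale[OF s, of "(b + 1) / (h \<bullet> s)"]] \<open>0 \<le> b\<close> by simp
  qed
  define G where "G = fst h"
  define \<beta> where "\<beta> = (\<lambda>x. - snd h $ x)"
  have hMD: "h \<bullet> (M, D) = (\<Sum>x\<in>UNIV. \<Sum>y\<in>UNIV. G $ x $ y * M $ x $ y) - (\<Sum>x\<in>UNIV. \<beta> x * D $ x)" for M D
    by (simp add: inner_prod_def inner_vec_def G_def \<beta>_def sum_negf)
  have \<beta>0: "0 \<le> \<beta> x" for x
  proof -
    have "h \<bullet> (0, axis x 1) \<le> 0" by (intro cone pureS) (auto simp: axis_def)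
    then show ?thesis by (simp add: inner_prod_def inner_axis \<beta>_def)
  qed
  have G0: "G $ x $ y = 0" if "\<not> (\<not> g x \<and> g y)" for x y
  proof -
    have "h \<bullet> (t *\<^sub>R axis x (axis y 1), 0) \<le> 0" for t
      using that by (intro cone pureS) (auto simp: axis_def)
    from this[of 1] this[of "-1"] show ?thesis
      by (simp add: inner_prod_def inner_axis G_def)
  qed
  have quad: "(\<Sum>x\<in>UNIV. \<Sum>y\<in>UNIV. if x $ j \<noteq> y $ j then G $ x $ y * (c x * c y) else 0) \<le>
      (\<Sum>x\<in>UNIV. \<beta> x * (c x)\<^sup>2)" for j c
    using cone[OF rankS[of j c]] by (simp add: hMD if_distrib cong: if_cong)
  have total: "W * (\<Sum>x\<in>UNIV. \<beta> x) \<le> (\<Sum>x\<in>UNIV. \<Sum>y\<in>UNIV. G $ x $ y)"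
    using ht \<open>0 \<le> b\<close> by (simp add: target_def hMD sum_distrib_left mult.commute)
  \<comment> \<open>Tests \<open>quad\<close> on vectors supported on \<open>x\<close> and
    \<open>y\<close>, with \<open>j\<close> a bit telling them apart; of the entries of
    \<open>G\<close> involved, only \<open>G $ x $ y\<close> survives.\<close>
  have pair: "G $ x $ y * (s * t) \<le> \<beta> x * s\<^sup>2 + \<beta> y * t\<^sup>2" if "\<not> g x" "g y" for x y s t
  proof -
    have "x \<noteq> y" using that by auto
    then obtain j where j: "x $ j \<noteq> y $ j" unfolding vec_eq_iff by blast
    define c where "c = (\<lambda>a. if a = x then s else if a = y then t else 0)"
    have c0: "c a = 0" if "a \<notin> {x, y}" for a using that by (simp add: c_def)
    have "(\<Sum>a\<in>UNIV. \<Sum>b\<in>UNIV. if a $ j \<noteq> b $ j then G $ a $ b * (c a * c b) else 0) =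
        (\<Sum>a\<in>{x, y}. \<Sum>b\<in>UNIV. if a $ j \<noteq> b $ j then G $ a $ b * (c a * c b) else 0)"
      by (intro sum.mono_neutral_right ballI sum.neutral) (auto simp: c0)
    also have "\<dots> = (\<Sum>a\<in>{x, y}. \<Sum>b\<in>{x, y}. if a $ j \<noteq> b $ j then G $ a $ b * (c a * c b) else 0)"
      by (intro sum.cong refl sum.mono_neutral_right ballI) (auto simp: c0)
    also have "\<dots> = G $ x $ y * (s * t)"
      using \<open>x \<noteq> y\<close> j G0[of y x] that by (auto simp: c_def)
    finally have 1: "(\<Sum>a\<in>UNIV. \<Sum>b\<in>UNIV. if a $ j \<noteq> b $ j then G $ a $ b * (c a * c b) else 0) = G $ x $ y * (s * t)" .
    have "(\<Sum>a\<in>UNIV. \<beta> a * (c a)\<^sup>2) = (\<Sum>a\<in>{x, y}. \<beta> a * (c a)\<^sup>2)"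
      by (intro sum.mono_neutral_right) (auto simp: c0)
    also have "\<dots> = \<beta> x * s\<^sup>2 + \<beta> y * t\<^sup>2"
      using \<open>x \<noteq> y\<close> by (simp add: c_def)
    finally show ?thesis using quad[of j c] 1 by simp
  qed
  \<comment> \<open>With one weight zero, \<open>pair\<close> bounds a linear function of a free
    parameter, so its slope \<open>G $ x $ y\<close> is zero. This makes the division by
    \<open>sqrt (\<beta> x)\<close> below harmless.\<close>
  have G\<beta>: "G $ x $ y = 0" if "\<beta> x = 0 \<or> \<beta> y = 0" for x y
  proof (cases "\<not> g x \<and> g y")
    case True
    show ?thesis
    proof (rule ccontr)
      assume nz: "G $ x $ y \<noteq> 0"
      from that show False
      proof
        assume "\<beta> x = 0"
        then show False
          using nz pair[of x y "(\<beta> y + 1) / G $ x $ y" 1] True by simp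
      next
        assume "\<beta> y = 0"
        then show False
          using nz pair[of x y 1 "(\<beta> x + 1) / G $ x $ y"] True by simp
      qed
    qed
  qed (rule G0)
  have "\<exists>x. \<beta> x \<noteq> 0"
  proof (rule ccontr)
    assume "\<not> (\<exists>x. \<beta> x \<noteq> 0)"
    then have "snd h = 0" "fst h = 0"
      using G\<beta> by (auto simp: vec_eq_iff \<beta>_def G_def)
    then show False using h by (simp add: prod_eq_iff)
  qed
  then obtain x where "0 < \<beta> x" using \<beta>0 by (metis less_eq_real_def)
  then have \<beta>pos: "0 < (\<Sum>x\<in>UNIV. \<beta> x)"
    using \<beta>0 by (intro sum_pos2[of _ x]) auto
  \<comment> \<open>The factor 2 compensates for the symmetrisation: the quadratic form of
    \<open>\<Gamma>\<close> at \<open>\<delta>\<close> is the plain sum of the entries of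
    \<open>G\<close>. Entries with a zero weight are 0 through division by zero.\<close>
  define \<Gamma> where "\<Gamma> = (\<chi> x y. (G $ x $ y + G $ y $ x) / (2 * (sqrt (\<beta> x) * sqrt (\<beta> y))))"
  define \<delta> where "\<delta> = (\<chi> x. sqrt (\<beta> x))"
  have adv: "adversary_matrix g \<Gamma>"
    unfolding adversary_matrix_def
  proof (intro conjI allI impI)
    show "transpose \<Gamma> = \<Gamma>"
      by (simp add: transpose_def \<Gamma>_def vec_eq_iff add.commute mult.commute)
  next
    fix x y assume "g x = g y"
    then show "\<Gamma> $ x $ y = 0" by (simp add: \<Gamma>_def G0)
  next
    fix j
    define H where "H = hadamard \<Gamma> (diff_matrix j)"
    define Q where "Q = (\<lambda>c. \<Sum>x\<in>UNIV. \<Sum>y\<in>UNIV. if x $ j \<noteq> y $ j then G $ x $ y * (c x * c y) else 0)"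
    show "spectral_norm (hadamard \<Gamma> (diff_matrix j)) \<le> 1"
      unfolding H_def[symmetric]
    proof (rule spectral_norm_le_quadratic)
      show "transpose H = H"
        by (auto simp: transpose_def H_def hadamard_def diff_matrix_def \<Gamma>_def vec_eq_iff add.commute mult.commute)
    next
      fix w :: "real ^ (bool ^ 'm)"
      \<comment> \<open>Undoes the rescaling in \<open>\<Gamma>\<close>. Coordinates of zero weight
        are dropped, hence an inequality and not an equality in \<open>Q_le\<close>.\<close>
      define c where "c = (\<lambda>x. w $ x / sqrt (\<beta> x))"
      have Q_le: "Q (\<lambda>x. \<epsilon> x * c x) \<le> (norm w)\<^sup>2" if "\<And>x. (\<epsilon> x)\<^sup>2 = 1" for \<epsilon>
      proof -
        have "Q (\<lambda>x. \<epsilon> x * c x) \<le> (\<Sum>x\<in>UNIV. \<beta> x * (\<epsilon> x * c x)\<^sup>2)"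
          unfolding Q_def by (rule quad)
        also have "\<dots> \<le> (\<Sum>x\<in>UNIV. w $ x * w $ x)"
        proof (rule sum_mono)
          fix x
          have "(\<epsilon> x * c x)\<^sup>2 = (c x)\<^sup>2"
            by (simp add: power_mult_distrib that)
          moreover have "\<beta> x * (c x)\<^sup>2 \<le> w $ x * w $ x"
            using \<beta>0[of x] by (simp add: c_def power_divide power2_eq_square)
          ultimately show "\<beta> x * (\<epsilon> x * c x)\<^sup>2 \<le> w $ x * w $ x" by simp
        qed
        also have "\<dots> = (norm w)\<^sup>2"
          by (simp add: power2_norm_eq_inner inner_vec_def)
        finally show ?thesis .
      qed
      \<comment> \<open>\<open>G\<close> is bipartite, so a sign flip on one side turns the upper bound into a two-sided one.\<close>
      have "Q (\<lambda>x. (if g x then -1 else 1) * c x) = - Q c"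
        unfolding Q_def sum_negf[symmetric] using G0 by (intro sum.cong refl) auto
      moreover have "Q (\<lambda>x. (if g x then -1 else 1) * c x) \<le> (norm w)\<^sup>2"
        by (rule Q_le) simp
      ultimately have absQ: "\<bar>Q c\<bar> \<le> (norm w)\<^sup>2"
        using Q_le[of "\<lambda>_. 1"] by simp
      have "2 * (a * b * ((p + q) / (2 * (s * t)))) = p * (a / s * (b / t)) + q * (b / t * (a / s))"
        for a b p q s t :: real
        by (cases "s = 0 \<or> t = 0") (auto simp: field_simps)
      then have "2 * (w \<bullet> (H *v w)) = (\<Sum>x\<in>UNIV. \<Sum>y\<in>UNIV.
          (if x $ j \<noteq> y $ j then G $ x $ y * (c x * c y) else 0) + (if y $ j \<noteq> x $ j then G $ y $ x * (c y * c x) else 0))"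
        unfolding inner_matrix_vector sum_distrib_left
        by (intro sum.cong refl) (auto simp: H_def hadamard_def diff_matrix_def \<Gamma>_def c_def)
      also have "\<dots> = Q c + Q c"
        unfolding sum.distrib Q_def
        by (intro arg_cong2[of _ _ _ _ "(+)"] refl) (rule sum.swap)
      finally show "\<bar>w \<bullet> (H *v w)\<bar> \<le> 1 * (norm w)\<^sup>2"
        using absQ by simp
    qed
  qed
  have norm\<delta>: "(norm \<delta>)\<^sup>2 = (\<Sum>x\<in>UNIV. \<beta> x)"
    using \<beta>0 by (simp add: power2_norm_eq_inner inner_vec_def \<delta>_def)
  have "2 * (\<delta> \<bullet> (\<Gamma> *v \<delta>)) = (\<Sum>x\<in>UNIV. \<Sum>y\<in>UNIV. G $ x $ y + G $ y $ x)"
    unfolding inner_matrix_vector sum_distrib_left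
  proof (intro sum.cong refl)
    fix x y
    show "2 * (\<delta> $ x * \<delta> $ y * \<Gamma> $ x $ y) = G $ x $ y + G $ y $ x"
      using G\<beta>[of x y] G\<beta>[of y x] by (cases "\<beta> x = 0 \<or> \<beta> y = 0") (auto simp: \<delta>_def \<Gamma>_def)
  qed
  also have "\<dots> = 2 * (\<Sum>x\<in>UNIV. \<Sum>y\<in>UNIV. G $ x $ y)"
    using sum.swap[of "\<lambda>x y. G $ y $ x" UNIV UNIV] by (simp add: sum.distrib)
  \<comment> \<open>The Rayleigh quotient of the feasible \<open>\<Gamma>\<close> at
    \<open>\<delta>\<close> is thus at least \<open>W\<close>, contradicting
    \<open>ADV g < W\<close>.\<close>
  finally have "W * (norm \<delta>)\<^sup>2 \<le> \<delta> \<bullet> (\<Gamma> *v \<delta>)"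
    using total norm\<delta> by simp
  also have "\<dots> \<le> ADV g * (norm \<delta>)\<^sup>2"
    using spectral_norm_le_ADV[OF adv, unfolded spectral_norm_le_iff, rule_format, of \<delta> \<delta>] by simp
  finally show False using W \<beta>pos norm\<delta> by simp
qed

subsection \<open>Upper bound for compositions\<close>

lemma ADV_rel_compose_le:
  fixes f :: "((bool ^ 'n::finite) \<times> 'k::finite) set" and g :: "bool ^ 'm::finite \<Rightarrow> bool"
  assumes feas: "rel_feasible f d e u v \<sigma>" and W: "ADV g < W"
  shows "ADV_rel (rel_compose f g) \<le> rel_cost d u v * W"
proof -
  obtain X :: "'m \<Rightarrow> bool ^ 'm \<Rightarrow> bool ^ 'm \<Rightarrow> real" where
    X: "\<And>j a b. X j a b = X j b a" "\<And>j c. 0 \<le> (\<Sum>a\<in>UNIV. \<Sum>b\<in>UNIV. c a * c b * X j a b)"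
    and X1: "\<And>x y. \<not> g x \<Longrightarrow> g y \<Longrightarrow> (\<Sum>j\<in>{j. x $ j \<noteq> y $ j}. X j x y) = 1"
    and XW: "\<And>x. (\<Sum>j\<in>UNIV. X j x x) \<le> W"
    using ADV_dual[OF W] by blast
  have "\<exists>r :: bool ^ 'm \<Rightarrow> bool ^ 'm \<Rightarrow> real. \<forall>a\<in>UNIV. \<forall>b\<in>UNIV. X j a b = (\<Sum>s\<in>UNIV. r a s * r b s)" for j
    by (rule psd_gram) (use X in auto)
  then obtain r :: "'m \<Rightarrow> bool ^ 'm \<Rightarrow> bool ^ 'm \<Rightarrow> real" where
    r: "\<And>j a b. (\<Sum>s\<in>UNIV. r j a s * r j b s) = X j a b"
    by (metis UNIV_I)
  have W0: "0 \<le> W" using W ADV_nonneg[of g] by simp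
  \<comment> \<open>The dual fixes the sum for one order of the pair only; symmetry of
    \<open>X\<close> gives the other.\<close>
  have sum1: "(\<Sum>j\<in>{j. a $ j \<noteq> b $ j}. X j a b) = 1" if "g a \<noteq> g b" for a b
  proof (cases "g a")
    case False
    then show ?thesis using X1[of a b] that by simp
  next
    case True
    then have "(\<Sum>j\<in>{j. b $ j \<noteq> a $ j}. X j b a) = 1" using X1[of b a] that by simp
    moreover have "{j. b $ j \<noteq> a $ j} = {j. a $ j \<noteq> b $ j}" by auto
    ultimately show ?thesis using X(1)[of _ a b] by simp
  qed
  define I where "I = {..<d} \<times> (UNIV :: (bool ^ 'm) set) \<times> (UNIV :: bool set)"
  \<comment> \<open>The Boolean coordinate \<open>t\<close> puts \<open>u'\<close> at the value of
    \<open>g\<close> on the block and \<open>v'\<close> at the opposite one. Inner products then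
    vanish when the two blocks have equal \<open>g\<close>-value, where the dual solution is
    unconstrained.\<close>
  define u' where "u' = (\<lambda>x (i, j) (k, s, t). u (outer g x) i k * (if t = g (block x i) then r j (block x i) s else 0))"
  define v' where "v' = (\<lambda>x (i, j) (k, s, t). v (outer g x) i k * (if t \<noteq> g (block x i) then r j (block x i) s else 0))"
  define \<sigma>' where "\<sigma>' = (\<lambda>x a k. if k < e then \<sigma> (outer g x) a k else 0)"
  have uv: "(\<Sum>k\<in>I. u' x (i, j) k * v' y (i, j) k) = dot d (u (outer g x) i) (v (outer g y) i) *
      (if g (block x i) \<noteq> g (block y i) then X j (block x i) (block y i) else 0)" for x y i j
  proof -
    have "(\<Sum>k\<in>I. u' x (i, j) k * v' y (i, j) k) = (\<Sum>k<d. \<Sum>s\<in>UNIV.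
        (u (outer g x) i k * v (outer g y) i k) *
        (if g (block x i) \<noteq> g (block y i) then r j (block x i) s * r j (block y i) s else 0))"
      unfolding I_def sum.cartesian_product'
      by (intro sum.cong refl) (auto simp: u'_def v'_def UNIV_bool)
    also have "\<dots> = dot d (u (outer g x) i) (v (outer g y) i) *
        (\<Sum>s\<in>UNIV. if g (block x i) \<noteq> g (block y i) then r j (block x i) s * r j (block y i) s else 0)"
      unfolding dot_def sum_product ..
    finally show ?thesis by (simp add: r)
  qed
  have sq: "(\<Sum>k\<in>I. (u' x (i, j) k)\<^sup>2) = dot d (u (outer g x) i) (u (outer g x) i) * X j (block x i) (block x i)"
    "(\<Sum>k\<in>I. (v' x (i, j) k)\<^sup>2) = dot d (v (outer g x) i) (v (outer g x) i) * X j (block x i) (block x i)" for x i j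
  proof -
    show "(\<Sum>k\<in>I. (u' x (i, j) k)\<^sup>2) = dot d (u (outer g x) i) (u (outer g x) i) * X j (block x i) (block x i)"
      unfolding dot_def r[symmetric] sum_product I_def sum.cartesian_product'
      by (intro sum.cong refl) (auto simp: u'_def UNIV_bool power2_eq_square)
    show "(\<Sum>k\<in>I. (v' x (i, j) k)\<^sup>2) = dot d (v (outer g x) i) (v (outer g x) i) * X j (block x i) (block x i)"
      unfolding dot_def r[symmetric] sum_product I_def sum.cartesian_product'
      by (intro sum.cong refl) (auto simp: v'_def UNIV_bool power2_eq_square)
  qed
  have cost: "(\<Sum>p\<in>UNIV. dot d (w (fst p)) (w (fst p)) * X (snd p) (block x (fst p)) (block x (fst p))) \<le> C * W"
    if w: "(\<Sum>i\<in>UNIV. dot d (w i) (w i)) \<le> C" for w C and x :: "bool ^ ('n \<times> 'm)"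
  proof -
    have "(\<Sum>p\<in>UNIV. dot d (w (fst p)) (w (fst p)) * X (snd p) (block x (fst p)) (block x (fst p))) =
        (\<Sum>i\<in>UNIV. dot d (w i) (w i) * (\<Sum>j\<in>UNIV. X j (block x i) (block x i)))"
      unfolding UNIV_Times_UNIV[symmetric] sum.cartesian_product' by (simp add: sum_distrib_left)
    also have "\<dots> \<le> (\<Sum>i\<in>UNIV. dot d (w i) (w i) * W)"
      by (intro sum_mono mult_left_mono XW) (auto simp: dot_def intro: sum_nonneg)
    also have "\<dots> \<le> C * W"
      unfolding sum_distrib_right[symmetric] using w W0 by (rule mult_right_mono)
    finally show ?thesis .
  qed
  have "\<exists>d' e' u' v' \<sigma>'. rel_feasible (rel_compose f g) d' e' u' v' \<sigma>' \<and> rel_cost d' u' v' \<le> rel_cost d u v * W"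
  proof (rule rel_feasible_of_indexed[where I = I and J = "{..<e}" and u = u' and v = v' and \<sigma> = \<sigma>'])
    show "finite I" by (simp add: I_def)
  next
    fix x a k assume "(x, a) \<notin> rel_compose f g"
    then show "\<sigma>' x a k = 0"
      using feas by (simp add: mem_rel_compose \<sigma>'_def rel_feasible_def)
  next
    fix x
    have "rel_cost d u v \<le> rel_cost d u v" by simp
    then have "(\<Sum>i\<in>UNIV. dot d (u z i) (u z i)) \<le> rel_cost d u v"
      "(\<Sum>i\<in>UNIV. dot d (v z i) (v z i)) \<le> rel_cost d u v" for z
      unfolding rel_cost_le_iff by auto
    from this[THEN cost, of "outer g x" x]
    show "(\<Sum>p\<in>UNIV. \<Sum>k\<in>I. (u' x p k)\<^sup>2) \<le> rel_cost d u v * W"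
      "(\<Sum>p\<in>UNIV. \<Sum>k\<in>I. (v' x p k)\<^sup>2) \<le> rel_cost d u v * W"
      by (simp_all flip: sq)
  next
    fix x y :: "bool ^ ('n \<times> 'm)"
    have "(\<Sum>p\<in>{p. x $ p \<noteq> y $ p}. \<Sum>k\<in>I. u' x p k * v' y p k) =
        (\<Sum>p\<in>UNIV. if x $ p \<noteq> y $ p then \<Sum>k\<in>I. u' x p k * v' y p k else 0)"
      by (simp add: sum.If_cases)
    also have "\<dots> = (\<Sum>i\<in>UNIV. \<Sum>j\<in>UNIV. if block x i $ j \<noteq> block y i $ j then \<Sum>k\<in>I. u' x (i, j) k * v' y (i, j) k else 0)"
      unfolding UNIV_Times_UNIV[symmetric] sum.cartesian_product' by simp
    \<comment> \<open>Summed over \<open>j\<close>, a block with different \<open>g\<close>-values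
      contributes exactly the inner product for \<open>f\<close>, by \<open>sum1\<close>; the others
      contribute nothing.\<close>
    also have "\<dots> = (\<Sum>i\<in>UNIV. if outer g x $ i \<noteq> outer g y $ i then dot d (u (outer g x) i) (v (outer g y) i) else 0)"
    proof (intro sum.cong refl)
      fix i
      have "(\<Sum>j\<in>UNIV. if block x i $ j \<noteq> block y i $ j then \<Sum>k\<in>I. u' x (i, j) k * v' y (i, j) k else 0) =
          (\<Sum>j\<in>{j. block x i $ j \<noteq> block y i $ j}. \<Sum>k\<in>I. u' x (i, j) k * v' y (i, j) k)"
        by (simp add: sum.If_cases)
      also have "\<dots> = dot d (u (outer g x) i) (v (outer g y) i) * (if g (block x i) \<noteq> g (block y i)
          then \<Sum>j\<in>{j. block x i $ j \<noteq> block y i $ j}. X j (block x i) (block y i) else 0)"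
        unfolding uv sum_distrib_left[symmetric] by simp
      also have "\<dots> = (if outer g x $ i \<noteq> outer g y $ i then dot d (u (outer g x) i) (v (outer g y) i) else 0)"
        using sum1[of "block x i" "block y i"] by (cases "g (block x i) = g (block y i)") simp_all
      finally show "(\<Sum>j\<in>UNIV. if block x i $ j \<noteq> block y i $ j then \<Sum>k\<in>I. u' x (i, j) k * v' y (i, j) k else 0) = \<dots>" .
    qed
    also have "\<dots> = (\<Sum>i\<in>{i. outer g x $ i \<noteq> outer g y $ i}. dot d (u (outer g x) i) (v (outer g y) i))"
      by (simp add: sum.If_cases del: outer_nth)
    also have "\<dots> = 1 - (\<Sum>a\<in>UNIV. \<Sum>k\<in>{..<e}. \<sigma>' x a k * \<sigma>' y a k)"
      using feas by (simp add: rel_feasible_def \<sigma>'_def dot_def del: outer_nth)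
    finally show "(\<Sum>p\<in>{p. x $ p \<noteq> y $ p}. \<Sum>k\<in>I. u' x p k * v' y p k) =
        1 - (\<Sum>a\<in>UNIV. \<Sum>k\<in>{..<e}. \<sigma>' x a k * \<sigma>' y a k)" .
  qed simp
  then show ?thesis
    using ADV_rel_le_cost order_trans by blast
qed

lemma le_ADV_rel:
  assumes "\<forall>z. \<exists>a. (z, a) \<in> f" and "\<And>d e u v \<sigma>. rel_feasible f d e u v \<sigma> \<Longrightarrow> L \<le> rel_cost d u v"
  shows "L \<le> ADV_rel f"
  unfolding ADV_rel_def
proof (rule cInf_greatest)
  show "{rel_cost d u v | d e u v \<sigma>. rel_feasible f d e u v \<sigma>} \<noteq> {}"
    using rel_feasible_exists[OF assms(1)] by blast
qed (use assms(2) in blast)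

theorem corollary25:
  fixes f :: "((bool ^ 'n::finite) \<times> 'k::finite) set"
    and g :: "bool ^ 'm::finite \<Rightarrow> bool"
  assumes "\<forall>z. \<exists>a. (z, a) \<in> f"
  shows "ADV_rel (rel_compose f g) = ADV_rel f * ADV g"
proof (rule antisym)
  have cost: "ADV_rel (rel_compose f g) \<le> rel_cost d u v * ADV g" if "rel_feasible f d e u v \<sigma>" for d e u v \<sigma>
  proof (cases "rel_cost d u v = 0")
    case True
    then show ?thesis
      using ADV_rel_compose_le[OF that, of g "ADV g + 1"] by simp
  next
    case False
    then have pos: "0 < rel_cost d u v" using rel_cost_nonneg[of d u v] by simp
    \<comment> \<open>The bound is available only for \<open>W\<close> strictly above
      \<open>ADV g\<close>; density of the reals passes to the limit.\<close>
    have "ADV_rel (rel_compose f g) / rel_cost d u v \<le> ADV g"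
    proof (rule dense_ge)
      fix W assume "ADV g < W"
      from ADV_rel_compose_le[OF that this] show "ADV_rel (rel_compose f g) / rel_cost d u v \<le> W"
        using pos by (simp add: pos_divide_le_eq mult.commute)
    qed
    then show ?thesis using pos by (simp add: pos_divide_le_eq mult.commute)
  qed
  show "ADV_rel (rel_compose f g) \<le> ADV_rel f * ADV g"
  \<comment> \<open>If \<open>ADV g = 0\<close>, one feasible family suffices, since
    \<open>cost\<close> then gives the bound 0; otherwise one may divide and take the
    infimum.\<close>
  proof (cases "ADV g = 0")
    case True
    then show ?thesis
      using rel_feasible_exists[OF assms] cost by fastforce
  next
    case False
    then have pos: "0 < ADV g" using ADV_nonneg[of g] by simp
    have "ADV_rel (rel_compose f g) / ADV g \<le> ADV_rel f"
      using cost pos by (intro le_ADV_rel[OF assms]) (simp add: pos_divide_le_eq)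
    then show ?thesis using pos by (simp add: pos_divide_le_eq)
  qed
next
  have "\<forall>x. \<exists>a. (x, a) \<in> rel_compose f g"
    using assms by (simp add: mem_rel_compose)
  then show "ADV_rel f * ADV g \<le> ADV_rel (rel_compose f g)"
  proof (rule le_ADV_rel)
    fix d e u v \<sigma> assume feas: "rel_feasible (rel_compose f g) d e u v \<sigma>"
    have "0 \<le> ADV_rel f"
      by (rule le_ADV_rel[OF assms rel_cost_nonneg])
    show "ADV_rel f * ADV g \<le> rel_cost d u v"
    proof (cases "ADV_rel f = 0")
      case True
      then show ?thesis using rel_cost_nonneg[of d u v] by simp
    next
      case False
      then have pos: "0 < ADV_rel f" using \<open>0 \<le> ADV_rel f\<close> by simp
      have "ADV g \<le> rel_cost d u v / ADV_rel f"
        unfolding ADV_def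
      proof (rule cSup_least)
        show "{spectral_norm \<Gamma> | \<Gamma>. adversary_matrix g \<Gamma>} \<noteq> {}"
          using adversary_matrix_0[of g] by blast
        fix s assume "s \<in> {spectral_norm \<Gamma> | \<Gamma>. adversary_matrix g \<Gamma>}"
        then show "s \<le> rel_cost d u v / ADV_rel f"
          using ADV_rel_compose_ge[OF feas] pos by (auto simp: pos_le_divide_eq)
      qed
      then show ?thesis using pos by (simp add: pos_le_divide_eq mult.commute)
    qed
  qed
qed

end
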